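(* Let $p$ be an odd prime and let $(A,\psi)$ be a May--Steenrod complex. If $H_\psi$ is a Cartan relator for $(A,\psi)$, then $$\zeta_i(a,b) := H_\psi(p)(e_i)\big(a^{\otimes p}\otimes b^{\otimes p}\big)$$ defines a Cartan $i$-boundary construction. That is, $\zeta_i$ is a map from pairs of mod $p$ cycles to $A$, natural with respect to $E_\infty$-algebra chain maps, such that $$\partial\,\zeta_i(a,b) = C^p_\psi(i)(a,b)\quad\text{in } A\otimes\mathbb F_p.$$
   Context: The ground ring is $\mathbb Z$ and homological grading is used; $|a|$ denotes degree. Here $i\ge 0$ is an integer. **$\mathbb C$-modules.** $\mathbb C_r\subset\mathbb S_r$ is the cyclic group generated by $\rho=(1,2,\dots,r)$. A $\mathbb C$-module is a family $\{\mathcal P(r)\}_{r>0}$ of chain complexes with right $\mathbb C_r$-action; $\mathbb C$-equivariant maps are families of $\mathbb C_r$-equivariant maps (being a chain map, quasi-isomorphism or chain homotopy is meant for each $r$). Operads and $\mathbb S$-modules are $\mathbb C$-modules by restriction. **Minimal resolution.** $\mathcal W(r)$ is the complex of free $\mathbb Z[\mathbb C_r]$-modules with one generator $e_n$ in each degree $n\ge0$ and $\partial e_{2i+1}=(\rho-1)e_{2i}$, $\partial e_{2i}=(1+\rho+\dots+\rho^{r-1})e_{2i-1}$ (for $i\geq 1$). It has a $\mathbb C_r$-equivariant coproduct $\Delta:\mathcal W(r)\to\mathcal W(r)\otimes\mathcal W(r)$ (diagonal action on the target): $$\Delta(e_{2i})=\sum_{j+k=i}e_{2j}\otimes e_{2k}+\sum_{j+k=i-1}\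 \sum_{0\le s<t<r}\rho^s e_{2j+1}\otimes\rho^t e_{2k+1},$$ $$\Delta(e_{2i+1})=\sum_{j+k=i}\big(e_{2j}\otimes e_{2k+1}+e_{2j+1}\otimes\rho e_{2k}\big).$$ **May--Steenrod structures.** $\mathrm{End}(A)=\{\mathrm{Hom}(A^{\otimes r},A)\}_{r>0}$ is the endomorphism operad. An $E_\infty$-algebra structure on a chain complex $A$ is an operad morphism $\phi:\mathcal R\to\mathrm{End}(A)$ from an operad $\mathcal R$ such that each chain complex $\mathcal R(r)$ is contractible and has free $\mathbb S_r$-action. A May--Steenrod structure on $A$ is an $E_\infty$-structure $\phi$ together with a $\mathbb C$-equivariant quasi-isomorphism $\iota:\mathcal W\to\mathcal R$; put $\psi=\phi\circ\iota$. The pair $(A,\psi)$ is a May--Steenrod complex. Write $a\smile b=\psi(2)(e_0)(a\otimes b)$ and $\psi_i=\psi(p)(e_i):A^{\otimes p}\to A$. **Cartan relators.** $\mathrm{End}(A)^\wedge$ is the $\mathbb C$-module with $\mathrm{End}(A)^\wedge(r)=\mathrm{End}(A)(2r)$, with $\mathbb C_r$ acting through $\mathbb C_r\xrightarrow{\text{diag}}\mathbb C_r\times\mathbb C_r\subset\mathbb S_r\times\mathbb S_r\subset\mathbb S_{2r}$ (the two factors permuting $\{1,\dots,r\}$ and $\{r+1,\dots,2r\}$). Let $\mathcal O=\mathrm{End}(A)$, with operadic composition $\circ_{\mathcal O}$. Define $\mathbb C$-equivariant chain maps $F_\psi,G_\psi:\mathcal W\to\mathrm{End}(A)^\wedge$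 as the compositions $$F_\psi:\ \mathcal W(r)\xrightarrow{\psi(r)}\mathcal O(r)\xrightarrow{\mathrm{id}\otimes\psi(2)(e_0)^{\otimes r}}\mathcal O(r)\otimes\mathcal O(2)^{\otimes r}\xrightarrow{\circ_{\mathcal O}}\mathcal O(2r),$$ $$G_\psi:\ \mathcal W(r)\xrightarrow{\Delta}\mathcal W(r)^{\otimes2}\xrightarrow{\psi(r)^{\otimes2}}\mathcal O(r)^{\otimes2}\xrightarrow{\psi(2)(e_0)\otimes\mathrm{id}}\mathcal O(2)\otimes\mathcal O(r)^{\otimes2}\xrightarrow{\circ_{\mathcal O}}\mathcal O(2r).$$ Let $\tau=\tau_r\in\mathbb S_{2r}$ be given by $\tau(\ell)=2\ell-1$ for $\ell\le r$ and $\tau(\ell)=2(\ell-r)$ for $\ell>r$, so that $\tau(a^{\otimes r}\otimes b^{\otimes r})=(-1)^{\frac{r(r-1)}2|a||b|}(a\otimes b)^{\otimes r}$; $\tau F_\psi$ denotes $F_\psi$ followed by the action of $\tau$ on $\mathcal O(2r)$. A Cartan relator for $(A,\psi)$ is a $\mathbb C$-equivariant chain homotopy $H_\psi:\mathcal W\to\mathrm{End}(A)^\wedge$ between $\tau F_\psi$ and $G_\psi$, i.e. $\partial\circ H_\psi+H_\psi\circ\partial=\tau F_\psi-G_\psi$. **Lift of the Cartan formula.** For mod $p$ cycles $a,b$ (cycles of $A\otimes\mathbb F_p$), $$C^p_\psi(2i)(a,b)=(-1)^{\lfloor p/2\rfloor|a||b|}\psi_{2i}\big((a\smile b)^{\otimes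 p}\big)-\sum_{j+k=i}\psi_{2j}(a^{\otimes p})\smile\psi_{2k}(b^{\otimes p}),$$ $$C^p_\psi(2i+1)(a,b)=(-1)^{\lfloor p/2\rfloor|a||b|}\psi_{2i+1}\big((a\smile b)^{\otimes p}\big)-\sum_{j+k=i}\Big(\psi_{2j+1}(a^{\otimes p})\smile\psi_{2k}(b^{\otimes p})+(-1)^{|a|}\psi_{2j}(a^{\otimes p})\smile\psi_{2k+1}(b^{\otimes p})\Big).$$ **Cartan $i$-boundary construction.** A map $\zeta_i$ from pairs of mod $p$ cycles to $A$, natural with respect to $E_\infty$-algebra chain maps, such that $\partial\zeta_i(a,b)=C^p_\psi(i)(a,b)$ in $A\otimes\mathbb F_p$.
   Formalization: Naturality is proved for E∞-algebra chain maps (same operad) under which the Cartan relators of source and target correspond, in particular for relators induced from the operad by one common homotopy; for arbitrary, unrelated choices of relators naturality is false. *)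

theory Defs
  imports
    "HOL-Library.Function_Algebras"
    "HOL-Library.Poly_Mapping"
    "HOL-Combinatorics.Permutations"
    "HOL-Computational_Algebra.Primes"
begin

section \<open>Chain complexes of abelian groups\<close>

definition zmul :: "int \<Rightarrow> 'a::ab_group_add \<Rightarrow> 'a"
  where "zmul c x = (\<Sum>i<nat c. x) - (\<Sum>i<nat (- c). x)"

text \<open>The element \<open>(-1)^k x\<close>, for an integer exponent.\<close>

definition ksign :: "int \<Rightarrow> 'a::ab_group_add \<Rightarrow> 'a"
  where "ksign k x = (if even k then x else - x)"

text \<open>
  The degree \<open>n\<close> part is the subgroup \<open>chains C n\<close> of an ambient abelian group. Subgroups for
  different \<open>n\<close> may overlap: the degree is never read off an element, so the differential and all
  maps of complexes take it as an argument, and a homogeneous element is a pair \<open>(n, x)\<close> with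
  \<open>x \<in> chains C n\<close>.
\<close>

record 'a cplx =
  chains :: "int \<Rightarrow> 'a set"
  bd :: "int \<Rightarrow> 'a \<Rightarrow> 'a"

definition additive_on :: "'a::ab_group_add set \<Rightarrow> ('a \<Rightarrow> 'b::ab_group_add) \<Rightarrow> bool"
  where "additive_on S f \<longleftrightarrow> (\<forall>x\<in>S. \<forall>y\<in>S. f (x + y) = f x + f y)"

definition chain_complex :: "'a::ab_group_add cplx \<Rightarrow> bool"
  where "chain_complex C \<longleftrightarrow>
    (\<forall>n. 0 \<in> chains C n
       \<and> (\<forall>x\<in>chains C n. \<forall>y\<in>chains C n. x - y \<in> chains C n)
       \<and> (\<forall>x\<in>chains C n. bd C n x \<in> chains C (n - 1))
       \<and> additive_on (chains C n) (bd C n)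
       \<and> (\<forall>x\<in>chains C n. bd C (n - 1) (bd C n x) = 0))"

definition graded_map ::
    "int \<Rightarrow> 'a::ab_group_add cplx \<Rightarrow> 'b::ab_group_add cplx \<Rightarrow> (int \<Rightarrow> 'a \<Rightarrow> 'b) \<Rightarrow> bool"
  where "graded_map d C D f \<longleftrightarrow>
    (\<forall>n. (\<forall>x\<in>chains C n. f n x \<in> chains D (n + d)) \<and> additive_on (chains C n) (f n))"

definition chain_map ::
    "'a::ab_group_add cplx \<Rightarrow> 'b::ab_group_add cplx \<Rightarrow> (int \<Rightarrow> 'a \<Rightarrow> 'b) \<Rightarrow> bool"
  where "chain_map C D f \<longleftrightarrow> graded_map 0 C D f
    \<and> (\<forall>n. \<forall>x\<in>chains C n. bd D n (f n x) = f (n - 1) (bd C n x))"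

definition cycles :: "'a::ab_group_add cplx \<Rightarrow> int \<Rightarrow> 'a set"
  where "cycles C n = {x \<in> chains C n. bd C n x = 0}"

definition boundaries :: "'a::ab_group_add cplx \<Rightarrow> int \<Rightarrow> 'a set"
  where "boundaries C n = bd C (n + 1) ` chains C (n + 1)"

text \<open>The two clauses say that the induced map on homology is injective, resp. surjective.\<close>

definition quasi_iso ::
    "'a::ab_group_add cplx \<Rightarrow> 'b::ab_group_add cplx \<Rightarrow> (int \<Rightarrow> 'a \<Rightarrow> 'b) \<Rightarrow> bool"
  where "quasi_iso C D f \<longleftrightarrow> chain_map C D f
    \<and> (\<forall>n. \<forall>x\<in>cycles C n. f n x \<in> boundaries D n \<longrightarrow> x \<in> boundaries C n)
    \<and> (\<forall>n. \<forall>y\<in>cycles D n. \<exists>x\<in>cycles C n. y - f n x \<in> boundaries D n)"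

text \<open>
  Contractible in the operadic sense, i.e. homotopy equivalent to the complex of a point, \<open>\<int>\<close> in
  degree \<open>0\<close> (and not to the zero complex): \<open>\<epsilon>\<close> is the augmentation, \<open>u\<close> the image of
  \<open>1\<close> under its homotopy inverse and \<open>h\<close> the homotopy.
\<close>

definition contractible_complex :: "'a::ab_group_add cplx \<Rightarrow> bool"
  where "contractible_complex C \<longleftrightarrow>
    (\<exists>u \<epsilon> h. u \<in> cycles C 0
       \<and> additive_on (chains C 0) (\<epsilon> :: 'a \<Rightarrow> int) \<and> (\<forall>x\<in>chains C 1. \<epsilon> (bd C 1 x) = 0) \<and> \<epsilon> u = 1
       \<and> graded_map 1 C C h
       \<and> (\<forall>n. \<forall>x\<in>chains C n. bd C (n + 1) (h n x) + h (n - 1) (bd C n x)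
                              = x - (if n = 0 then zmul (\<epsilon> x) u else 0)))"


section \<open>Elementary tensors and multilinear maps\<close>

text \<open>
  A list of homogeneous elements stands for the elementary tensor of its entries. Maps out of a
  tensor product of complexes are multilinear maps on such lists.
\<close>

definition homog :: "'a cplx list \<Rightarrow> (int \<times> 'a) list \<Rightarrow> bool"
  where "homog Cs xs \<longleftrightarrow> list_all2 (\<lambda>C (n, x). x \<in> chains C n) Cs xs"

definition tdeg :: "(int \<times> 'a) list \<Rightarrow> int"
  where "tdeg xs = sum_list (map fst xs)"

definition multilinear ::
    "'a::ab_group_add cplx list \<Rightarrow> ((int \<times> 'a) list \<Rightarrow> 'b::ab_group_add) \<Rightarrow> bool"
  where "multilinear Cs f \<longleftrightarrow>
    (\<forall>xs i n x y. homog Cs xs \<and> i < length xs \<and> x \<in> chains (Cs ! i) n \<and> y \<in> chains (Cs ! i) n \<longrightarrow>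
       f (xs[i := (n, x + y)]) = f (xs[i := (n, x)]) + f (xs[i := (n, y)]))"

text \<open>The value of \<open>f\<close> on the boundary of the tensor \<open>xs\<close>.\<close>

definition on_tensor_bd ::
    "'a::ab_group_add cplx list \<Rightarrow> ((int \<times> 'a) list \<Rightarrow> 'b::ab_group_add) \<Rightarrow> (int \<times> 'a) list \<Rightarrow> 'b"
  where "on_tensor_bd Cs f xs =
    (\<Sum>i<length xs. ksign (tdeg (take i xs))
       (f (xs[i := (fst (xs ! i) - 1, bd (Cs ! i) (fst (xs ! i)) (snd (xs ! i)))])))"

definition tensor_chain_map ::
    "'a::ab_group_add cplx list \<Rightarrow> 'b::ab_group_add cplx \<Rightarrow> ((int \<times> 'a) list \<Rightarrow> 'b) \<Rightarrow> bool"
  where "tensor_chain_map Cs D f \<longleftrightarrow> multilinear Cs f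
    \<and> (\<forall>xs. homog Cs xs \<longrightarrow> f xs \<in> chains D (tdeg xs) \<and> bd D (tdeg xs) (f xs) = on_tensor_bd Cs f xs)"

text \<open>
  Exponents of Koszul signs. The first is for the left action of a permutation \<open>\<sigma>\<close> moving the factor
  in place \<open>i\<close> to place \<open>\<sigma> i\<close>, that is \<open>xs \<mapsto> permute_list (inv \<sigma>) xs\<close>. The second is for the
  shuffle of factors of degrees \<open>d\<^sub>1 \<dots> d\<^sub>r e\<^sub>1 \<dots> e\<^sub>r\<close> into \<open>d\<^sub>1 e\<^sub>1 \<dots> d\<^sub>r e\<^sub>r\<close>.
\<close>

definition koszul_exp :: "(nat \<Rightarrow> nat) \<Rightarrow> int list \<Rightarrow> int"
  where "koszul_exp \<sigma> ds = (\<Sum>(i, j)\<in>{(i, j). i < j \<and> j < length ds \<and> \<sigma> j < \<sigma> i}. ds ! i * ds ! j)"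

definition shuffle_exp :: "int list \<Rightarrow> int list \<Rightarrow> int"
  where "shuffle_exp ds es = (\<Sum>j<length ds. \<Sum>i<j. ds ! j * es ! i)"


section \<open>Permutations\<close>

text \<open>
  \<open>S_r\<close> consists of the permutations of \<open>{..<r}\<close>: places are counted from \<open>0\<close>.
\<close>

definition rot :: "nat \<Rightarrow> nat \<Rightarrow> nat"
  where "rot r l = (if l < r then (l + 1) mod r else l)"

definition tau :: "nat \<Rightarrow> nat \<Rightarrow> nat"
  where "tau r l = (if l < r then 2 * l else if l < 2 * r then 2 * (l - r) + 1 else l)"

text \<open>\<open>perm_sum ns \<sigma>s\<close> permutes the \<open>i\<close>-th of consecutive blocks of sizes \<open>ns\<close> by the \<open>i\<close>-th
  permutation; \<open>block_perm ns \<sigma>\<close> moves the \<open>i\<close>-th block as a whole to place \<open>\<sigma> i\<close>.\<close>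

fun perm_sum :: "nat list \<Rightarrow> (nat \<Rightarrow> nat) list \<Rightarrow> nat \<Rightarrow> nat" where
  "perm_sum (n # ns) (\<sigma> # \<sigma>s) l = (if l < n then \<sigma> l else n + perm_sum ns \<sigma>s (l - n))"
| "perm_sum _ _ l = l"

fun locate :: "nat list \<Rightarrow> nat \<Rightarrow> nat \<times> nat" where
  "locate [] l = (0, l)"
| "locate (n # ns) l = (if l < n then (0, l) else let (j, k) = locate ns (l - n) in (Suc j, k))"

definition block_perm :: "nat list \<Rightarrow> (nat \<Rightarrow> nat) \<Rightarrow> nat \<Rightarrow> nat"
  where "block_perm ns \<sigma> l =
    (if l < sum_list ns
     then let (j, k) = locate ns l in (\<Sum>i\<in>{i. i < length ns \<and> \<sigma> i < \<sigma> j}. ns ! i) + k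
     else l)"


section \<open>Operads\<close>

text \<open>
  \<open>opact P r n \<sigma> x\<close> is the right action of \<open>\<sigma>\<close> on \<open>x\<close> of arity \<open>r\<close> and degree \<open>n\<close>;
  \<open>opcomp P ns f gs\<close> is the composition \<open>f \<otimes> g\<^sub>1 \<otimes> \<dots> \<otimes> g\<^sub>r \<mapsto> f(g\<^sub>1, \<dots>, g\<^sub>r)\<close>, where \<open>ns\<close> lists the
  arities of the \<open>g\<^sub>i\<close>. All arities are positive.
\<close>

record 'o operad_data =
  opc :: "nat \<Rightarrow> 'o cplx"
  opact :: "nat \<Rightarrow> int \<Rightarrow> (nat \<Rightarrow> nat) \<Rightarrow> 'o \<Rightarrow> 'o"
  opcomp :: "nat list \<Rightarrow> int \<times> 'o \<Rightarrow> (int \<times> 'o) list \<Rightarrow> 'o"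
  opone :: "'o"

definition arity_list :: "nat list \<Rightarrow> bool"
  where "arity_list ns \<longleftrightarrow> ns \<noteq> [] \<and> (\<forall>n\<in>set ns. 0 < n)"

locale operad =
  fixes P :: "'o::ab_group_add operad_data"
  assumes complex: "0 < r \<Longrightarrow> chain_complex (opc P r)"
    and act_chain_map:
      "0 < r \<Longrightarrow> \<sigma> permutes {..<r} \<Longrightarrow> chain_map (opc P r) (opc P r) (\<lambda>n. opact P r n \<sigma>)"
    and act_id: "0 < r \<Longrightarrow> x \<in> chains (opc P r) n \<Longrightarrow> opact P r n id x = x"
    and act_comp:
      "0 < r \<Longrightarrow> x \<in> chains (opc P r) n \<Longrightarrow> \<sigma> permutes {..<r} \<Longrightarrow> \<pi> permutes {..<r} \<Longrightarrow>
       opact P r n (\<sigma> \<circ> \<pi>) x = opact P r n \<pi> (opact P r n \<sigma> x)"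
    and one_cycle: "opone P \<in> cycles (opc P 1) 0"
    and comp_chain_map:
      "arity_list ns \<Longrightarrow>
       tensor_chain_map (opc P (length ns) # map (opc P) ns) (opc P (sum_list ns))
         (\<lambda>xs. opcomp P ns (hd xs) (tl xs))"
    and one_comp:
      "0 < r \<Longrightarrow> g \<in> chains (opc P r) d \<Longrightarrow> opcomp P [r] (0, opone P) [(d, g)] = g"
    and comp_one:
      "0 < r \<Longrightarrow> f \<in> chains (opc P r) d \<Longrightarrow>
       opcomp P (replicate r 1) (d, f) (replicate r (0, opone P)) = f"
    and comp_assoc:
      "arity_list ns \<Longrightarrow> f \<in> chains (opc P (length ns)) d \<Longrightarrow> homog (map (opc P) ns) gs \<Longrightarrow>
       length mss = length ns \<Longrightarrow> length hss = length ns \<Longrightarrow>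
       (\<And>i. i < length ns \<Longrightarrow> length (mss ! i) = ns ! i \<and> arity_list (mss ! i)
                             \<and> homog (map (opc P) (mss ! i)) (hss ! i)) \<Longrightarrow>
       opcomp P (concat mss) (d + tdeg gs, opcomp P ns (d, f) gs) (concat hss)
       = ksign (shuffle_exp (map fst gs) (map tdeg hss))
           (opcomp P (map sum_list mss) (d, f)
              (map (\<lambda>i. (fst (gs ! i) + tdeg (hss ! i), opcomp P (mss ! i) (gs ! i) (hss ! i)))
                   [0..<length ns]))"
    and comp_act_outer:
      "arity_list ns \<Longrightarrow> f \<in> chains (opc P (length ns)) d \<Longrightarrow> homog (map (opc P) ns) gs \<Longrightarrow>
       \<sigma> permutes {..<length ns} \<Longrightarrow>
       opcomp P ns (d, opact P (length ns) d \<sigma> f) gs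
       = ksign (koszul_exp \<sigma> (map fst gs))
           (opact P (sum_list ns) (d + tdeg gs) (block_perm ns \<sigma>)
              (opcomp P (permute_list (inv \<sigma>) ns) (d, f) (permute_list (inv \<sigma>) gs)))"
    and comp_act_inner:
      "arity_list ns \<Longrightarrow> f \<in> chains (opc P (length ns)) d \<Longrightarrow> homog (map (opc P) ns) gs \<Longrightarrow>
       length \<pi>s = length ns \<Longrightarrow> (\<And>i. i < length ns \<Longrightarrow> \<pi>s ! i permutes {..<ns ! i}) \<Longrightarrow>
       opcomp P ns (d, f)
         (map (\<lambda>i. (fst (gs ! i), opact P (ns ! i) (fst (gs ! i)) (\<pi>s ! i) (snd (gs ! i))))
              [0..<length ns])
       = opact P (sum_list ns) (d + tdeg gs) (perm_sum ns \<pi>s) (opcomp P ns (d, f) gs)"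

definition operad_morphism ::
    "'o::ab_group_add operad_data \<Rightarrow> 'q::ab_group_add operad_data \<Rightarrow> (nat \<Rightarrow> int \<Rightarrow> 'o \<Rightarrow> 'q) \<Rightarrow> bool"
  where "operad_morphism P Q \<phi> \<longleftrightarrow>
    (\<forall>r>0. chain_map (opc P r) (opc Q r) (\<phi> r))
    \<and> (\<forall>r>0. \<forall>n \<sigma>. \<forall>x\<in>chains (opc P r) n. \<sigma> permutes {..<r} \<longrightarrow>
         \<phi> r n (opact P r n \<sigma> x) = opact Q r n \<sigma> (\<phi> r n x))
    \<and> \<phi> 1 0 (opone P) = opone Q
    \<and> (\<forall>ns d f gs. arity_list ns \<and> f \<in> chains (opc P (length ns)) d \<and> homog (map (opc P) ns) gs \<longrightarrow>
         \<phi> (sum_list ns) (d + tdeg gs) (opcomp P ns (d, f) gs)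
         = opcomp Q ns (d, \<phi> (length ns) d f) (map2 (\<lambda>n (e, g). (e, \<phi> n e g)) ns gs))"

text \<open>Every \<open>P(r)\<^sub>n\<close> is a free \<open>\<int>[S_r]\<close>-module: the translates of some \<open>B\<close> form a \<open>\<int>\<close>-basis.\<close>

definition free_action :: "'o::ab_group_add operad_data \<Rightarrow> nat \<Rightarrow> bool"
  where "free_action P r \<longleftrightarrow>
    (\<forall>n. \<exists>B\<subseteq>chains (opc P r) n. \<forall>x\<in>chains (opc P r) n.
       \<exists>!c :: ('o \<times> (nat \<Rightarrow> nat)) \<Rightarrow>\<^sub>0 int.
         Poly_Mapping.keys c \<subseteq> B \<times> {\<sigma>. \<sigma> permutes {..<r}}
         \<and> x = (\<Sum>(b, \<sigma>)\<in>Poly_Mapping.keys c. zmul (Poly_Mapping.lookup c (b, \<sigma>)) (opact P r n \<sigma> b)))"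

definition E_infinity_operad :: "'o::ab_group_add operad_data \<Rightarrow> bool"
  where "E_infinity_operad R \<longleftrightarrow>
    operad R \<and> (\<forall>r>0. contractible_complex (opc R r) \<and> free_action R r)"


section \<open>The endomorphism operad\<close>

text \<open>
  An element of degree \<open>d\<close> of \<open>Hom(A\<^sup>\<otimes>\<^sup>r, A)\<close> is a multilinear map raising degrees by \<open>d\<close>, made
  unique by setting it to \<open>0\<close> on lists that are not elementary tensors of \<open>A\<^sup>\<otimes>\<^sup>r\<close>.
\<close>

type_synonym 'a multimap = "(int \<times> 'a) list \<Rightarrow> 'a"

definition End_cplx :: "'a::ab_group_add cplx \<Rightarrow> nat \<Rightarrow> 'a multimap cplx"
  where "End_cplx A r = \<lparr>
    chains = (\<lambda>d. {f. multilinear (replicate r A) f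
                    \<and> (\<forall>xs. if homog (replicate r A) xs then f xs \<in> chains A (tdeg xs + d) else f xs = 0)}),
    bd = (\<lambda>d f xs. if homog (replicate r A) xs
                   then bd A (tdeg xs + d) (f xs) - ksign d (on_tensor_bd (replicate r A) f xs)
                   else 0) \<rparr>"

fun blocks :: "nat list \<Rightarrow> 'b list \<Rightarrow> 'b list list" where
  "blocks [] xs = []"
| "blocks (n # ns) xs = take n xs # blocks ns (drop n xs)"

definition End_comp ::
    "'a::ab_group_add cplx \<Rightarrow> nat list \<Rightarrow> int \<times> 'a multimap \<Rightarrow> (int \<times> 'a multimap) list \<Rightarrow> 'a multimap"
  where "End_comp A ns f gs xs =
    (if homog (replicate (sum_list ns) A) xs
     then ksign (shuffle_exp (map fst gs) (map tdeg (blocks ns xs)))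
            (snd f (map2 (\<lambda>(d, g) ys. (d + tdeg ys, g ys)) gs (blocks ns xs)))
     else 0)"

definition End_operad :: "'a::ab_group_add cplx \<Rightarrow> 'a multimap operad_data"
  where "End_operad A = \<lparr>
    opc = End_cplx A,
    opact = (\<lambda>r n \<sigma> f xs. ksign (koszul_exp \<sigma> (map fst xs)) (f (permute_list (inv \<sigma>) xs))),
    opcomp = End_comp A,
    opone = (\<lambda>xs. if homog [A] xs then snd (hd xs) else 0) \<rparr>"


section \<open>C-modules\<close>

text \<open>The action of the cyclic group is given by that of its generator.\<close>

record 'a cmod =
  cmx :: "nat \<Rightarrow> 'a cplx"
  crho :: "nat \<Rightarrow> int \<Rightarrow> 'a \<Rightarrow> 'a"

definition C_graded_map ::
    "int \<Rightarrow> 'a::ab_group_add cmod \<Rightarrow> 'b::ab_group_add cmod \<Rightarrow> (nat \<Rightarrow> int \<Rightarrow> 'a \<Rightarrow> 'b) \<Rightarrow> bool"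
  where "C_graded_map d M N f \<longleftrightarrow>
    (\<forall>r>0. graded_map d (cmx M r) (cmx N r) (f r)
         \<and> (\<forall>n. \<forall>x\<in>chains (cmx M r) n. f r n (crho M r n x) = crho N r (n + d) (f r n x)))"

definition C_quasi_iso ::
    "'a::ab_group_add cmod \<Rightarrow> 'b::ab_group_add cmod \<Rightarrow> (nat \<Rightarrow> int \<Rightarrow> 'a \<Rightarrow> 'b) \<Rightarrow> bool"
  where "C_quasi_iso M N f \<longleftrightarrow>
    C_graded_map 0 M N f \<and> (\<forall>r>0. quasi_iso (cmx M r) (cmx N r) (f r))"

definition C_homotopy ::
    "'a::ab_group_add cmod \<Rightarrow> 'b::ab_group_add cmod \<Rightarrow> (nat \<Rightarrow> int \<Rightarrow> 'a \<Rightarrow> 'b)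
     \<Rightarrow> (nat \<Rightarrow> int \<Rightarrow> 'a \<Rightarrow> 'b) \<Rightarrow> (nat \<Rightarrow> int \<Rightarrow> 'a \<Rightarrow> 'b) \<Rightarrow> bool"
  where "C_homotopy M N f g H \<longleftrightarrow> C_graded_map 1 M N H
    \<and> (\<forall>r>0. \<forall>n. \<forall>x\<in>chains (cmx M r) n.
         bd (cmx N r) (n + 1) (H r n x) + H r (n - 1) (bd (cmx M r) n x) = f r n x - g r n x)"

definition C_restrict :: "'o operad_data \<Rightarrow> 'o cmod"
  where "C_restrict P = \<lparr> cmx = opc P, crho = (\<lambda>r n. opact P r n (rot r)) \<rparr>"

definition C_hat :: "'o operad_data \<Rightarrow> 'o cmod"
  where "C_hat P = \<lparr> cmx = (\<lambda>r. opc P (2 * r)),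
                     crho = (\<lambda>r n. opact P (2 * r) n (perm_sum [r, r] [rot r, rot r])) \<rparr>"


section \<open>The minimal resolution\<close>

text \<open>\<open>W r\<close> has the \<open>\<int>\<close>-basis \<open>\<rho>\<^sup>s e\<^sub>n\<close> (\<open>s < r\<close>), encoded as \<open>(n, s)\<close>; \<open>W r \<otimes> W r\<close> has as basis the
  pairs of such.\<close>

type_synonym wres = "(nat \<times> nat) \<Rightarrow>\<^sub>0 int"
type_synonym wres2 = "((nat \<times> nat) \<times> (nat \<times> nat)) \<Rightarrow>\<^sub>0 int"

definition wb :: "nat \<Rightarrow> nat \<Rightarrow> nat \<Rightarrow> wres"
  where "wb r s n = frag_of (n, s mod r)"

definition wb2 :: "nat \<Rightarrow> nat \<Rightarrow> nat \<Rightarrow> nat \<Rightarrow> nat \<Rightarrow> wres2"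
  where "wb2 r s n t m = frag_of ((n, s mod r), (m, t mod r))"

definition wgen :: "nat \<Rightarrow> wres"
  where "wgen n = frag_of (n, 0)"

definition W_bd_basis :: "nat \<Rightarrow> nat \<times> nat \<Rightarrow> wres"
  where "W_bd_basis r = (\<lambda>(n, s).
    if n = 0 then 0
    else if odd n then wb r (s + 1) (n - 1) - wb r s (n - 1)
    else (\<Sum>u<r. wb r (s + u) (n - 1)))"

definition W :: "wres cmod"
  where "W = \<lparr>
    cmx = (\<lambda>r. \<lparr> chains = (\<lambda>k. {w. Poly_Mapping.keys w \<subseteq> {(n, s). int n = k \<and> s < r}}),
                  bd = (\<lambda>k. frag_extend (W_bd_basis r)) \<rparr>),
    crho = (\<lambda>r k. frag_extend (\<lambda>(n, s). wb r (s + 1) n)) \<rparr>"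

text \<open>The coproduct of \<open>\<rho>\<^sup>u e\<^sub>n\<close>.\<close>

definition W_coprod_basis :: "nat \<Rightarrow> nat \<times> nat \<Rightarrow> wres2"
  where "W_coprod_basis r = (\<lambda>(n, u).
    let i = n div 2 in
    if even n
    then (\<Sum>(j, k)\<in>{(j, k). j + k = i}. wb2 r u (2 * j) u (2 * k))
       + (\<Sum>(j, k)\<in>{(j, k). j + k + 1 = i}. \<Sum>(s, t)\<in>{(s, t). s < t \<and> t < r}.
            wb2 r (u + s) (2 * j + 1) (u + t) (2 * k + 1))
    else (\<Sum>(j, k)\<in>{(j, k). j + k = i}.
            wb2 r u (2 * j) u (2 * k + 1) + wb2 r u (2 * j + 1) (u + 1) (2 * k)))"

definition W_coprod :: "nat \<Rightarrow> wres \<Rightarrow> wres2"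
  where "W_coprod r = frag_extend (W_coprod_basis r)"


section \<open>May--Steenrod structures and Cartan relators\<close>

definition psi_of ::
    "(nat \<Rightarrow> int \<Rightarrow> 'o \<Rightarrow> 'q) \<Rightarrow> (nat \<Rightarrow> int \<Rightarrow> wres \<Rightarrow> 'o) \<Rightarrow> nat \<Rightarrow> int \<Rightarrow> wres \<Rightarrow> 'q"
  where "psi_of \<phi> \<iota> r n w = \<phi> r n (\<iota> r n w)"

definition May_Steenrod ::
    "'o::ab_group_add operad_data \<Rightarrow> 'a::ab_group_add cplx \<Rightarrow> (nat \<Rightarrow> int \<Rightarrow> 'o \<Rightarrow> 'a multimap)
     \<Rightarrow> (nat \<Rightarrow> int \<Rightarrow> wres \<Rightarrow> 'o) \<Rightarrow> bool"
  where "May_Steenrod R A \<phi> \<iota> \<longleftrightarrow>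
    chain_complex A \<and> E_infinity_operad R \<and> operad_morphism R (End_operad A) \<phi>
    \<and> C_quasi_iso W (C_restrict R) \<iota>"

definition cartan_F ::
    "'q::ab_group_add operad_data \<Rightarrow> (nat \<Rightarrow> int \<Rightarrow> wres \<Rightarrow> 'q) \<Rightarrow> nat \<Rightarrow> int \<Rightarrow> wres \<Rightarrow> 'q"
  where "cartan_F P \<psi> r n w =
    opcomp P (replicate r 2) (n, \<psi> r n w) (replicate r (0, \<psi> 2 0 (wgen 0)))"

definition cartan_tauF ::
    "'q::ab_group_add operad_data \<Rightarrow> (nat \<Rightarrow> int \<Rightarrow> wres \<Rightarrow> 'q) \<Rightarrow> nat \<Rightarrow> int \<Rightarrow> wres \<Rightarrow> 'q"
  where "cartan_tauF P \<psi> r n w = opact P (2 * r) n (tau r) (cartan_F P \<psi> r n w)"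

text \<open>No Koszul signs appear in the next definition, since \<open>\<psi>\<close> and \<open>\<psi>(2)(e\<^sub>0)\<close> have degree \<open>0\<close>.\<close>

definition cartan_G ::
    "'q::ab_group_add operad_data \<Rightarrow> (nat \<Rightarrow> int \<Rightarrow> wres \<Rightarrow> 'q) \<Rightarrow> nat \<Rightarrow> int \<Rightarrow> wres \<Rightarrow> 'q"
  where "cartan_G P \<psi> r n w =
    (\<Sum>((k, s), (l, t))\<in>Poly_Mapping.keys (W_coprod r w).
       zmul (Poly_Mapping.lookup (W_coprod r w) ((k, s), (l, t)))
         (opcomp P [r, r] (0, \<psi> 2 0 (wgen 0))
            [(int k, \<psi> r (int k) (frag_of (k, s))), (int l, \<psi> r (int l) (frag_of (l, t)))]))"

definition cartan_relator ::
    "'a::ab_group_add cplx \<Rightarrow> (nat \<Rightarrow> int \<Rightarrow> wres \<Rightarrow> 'a multimap)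
     \<Rightarrow> (nat \<Rightarrow> int \<Rightarrow> wres \<Rightarrow> 'a multimap) \<Rightarrow> bool"
  where "cartan_relator A \<psi> H \<longleftrightarrow>
    C_homotopy W (C_hat (End_operad A)) (cartan_tauF (End_operad A) \<psi>) (cartan_G (End_operad A) \<psi>) H"


section \<open>Mod p cycles and the lift of the Cartan formula\<close>

text \<open>\<open>A \<otimes> F\<^sub>p\<close> is \<open>A / p A\<close>, and \<open>modp p A n x\<close> is the class of \<open>x\<close> in degree \<open>n\<close>. Mod p cycles are
  given by lifts to \<open>A\<close>.\<close>

definition modp :: "nat \<Rightarrow> 'a::ab_group_add cplx \<Rightarrow> int \<Rightarrow> 'a \<Rightarrow> 'a set"
  where "modp p A n x = {x + zmul (int p) z | z. z \<in> chains A n}"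

definition modp_cycle :: "nat \<Rightarrow> 'a::ab_group_add cplx \<Rightarrow> int \<times> 'a \<Rightarrow> bool"
  where "modp_cycle p A = (\<lambda>(n, a). a \<in> chains A n \<and> modp p A (n - 1) (bd A n a) = modp p A (n - 1) 0)"

definition smile ::
    "(nat \<Rightarrow> int \<Rightarrow> wres \<Rightarrow> 'a multimap) \<Rightarrow> int \<times> 'a \<Rightarrow> int \<times> 'a \<Rightarrow> int \<times> 'a"
  where "smile \<psi> a b = (fst a + fst b, \<psi> 2 0 (wgen 0) [a, b])"

text \<open>The homogeneous element \<open>\<psi>\<^sub>i (a\<^sup>\<otimes>\<^sup>p)\<close>.\<close>

definition psi_power ::
    "(nat \<Rightarrow> int \<Rightarrow> wres \<Rightarrow> 'a multimap) \<Rightarrow> nat \<Rightarrow> nat \<Rightarrow> int \<times> 'a \<Rightarrow> int \<times> 'a"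
  where "psi_power \<psi> p i a = (int p * fst a + int i, \<psi> p (int i) (wgen i) (replicate p a))"

definition cartan_C ::
    "(nat \<Rightarrow> int \<Rightarrow> wres \<Rightarrow> 'a::ab_group_add multimap) \<Rightarrow> nat \<Rightarrow> nat \<Rightarrow> int \<times> 'a \<Rightarrow> int \<times> 'a \<Rightarrow> 'a"
  where "cartan_C \<psi> p n a b =
    (let i = n div 2 in
     ksign (int (p div 2) * fst a * fst b) (snd (psi_power \<psi> p n (smile \<psi> a b)))
     - (if even n
        then (\<Sum>(j, k)\<in>{(j, k). j + k = i}.
                snd (smile \<psi> (psi_power \<psi> p (2 * j) a) (psi_power \<psi> p (2 * k) b)))
        else (\<Sum>(j, k)\<in>{(j, k). j + k = i}.
                snd (smile \<psi> (psi_power \<psi> p (2 * j + 1) a) (psi_power \<psi> p (2 * k) b))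
                + ksign (fst a)
                    (snd (smile \<psi> (psi_power \<psi> p (2 * j) a) (psi_power \<psi> p (2 * k + 1) b))))))"

definition cartan_zeta ::
    "(nat \<Rightarrow> int \<Rightarrow> wres \<Rightarrow> 'a multimap) \<Rightarrow> nat \<Rightarrow> nat \<Rightarrow> int \<times> 'a \<Rightarrow> int \<times> 'a \<Rightarrow> 'a"
  where "cartan_zeta H p i a b = H p (int i) (wgen i) (replicate p a @ replicate p b)"

definition zeta_deg :: "nat \<Rightarrow> nat \<Rightarrow> int \<times> 'a \<Rightarrow> int \<times> 'a \<Rightarrow> int"
  where "zeta_deg p i a b = int p * (fst a + fst b) + int i + 1"


section \<open>Maps of E-infinity algebras\<close>

definition hmap :: "(int \<Rightarrow> 'a \<Rightarrow> 'b) \<Rightarrow> int \<times> 'a \<Rightarrow> int \<times> 'b"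
  where "hmap f = (\<lambda>(n, x). (n, f n x))"

definition intertwines ::
    "'a cplx \<Rightarrow> (int \<Rightarrow> 'a \<Rightarrow> 'b) \<Rightarrow> nat \<Rightarrow> int \<Rightarrow> 'a multimap \<Rightarrow> 'b multimap \<Rightarrow> bool"
  where "intertwines A f r d \<mu> \<nu> \<longleftrightarrow>
    (\<forall>xs. homog (replicate r A) xs \<longrightarrow> f (tdeg xs + d) (\<mu> xs) = \<nu> (map (hmap f) xs))"

definition E_infinity_map ::
    "'o operad_data \<Rightarrow> 'a::ab_group_add cplx \<Rightarrow> (nat \<Rightarrow> int \<Rightarrow> 'o \<Rightarrow> 'a multimap)
     \<Rightarrow> 'b::ab_group_add cplx \<Rightarrow> (nat \<Rightarrow> int \<Rightarrow> 'o \<Rightarrow> 'b multimap) \<Rightarrow> (int \<Rightarrow> 'a \<Rightarrow> 'b) \<Rightarrow> bool"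
  where "E_infinity_map R A \<phi> B \<phi>' f \<longleftrightarrow> chain_map A B f
    \<and> (\<forall>r>0. \<forall>d. \<forall>x\<in>chains (opc R r) d. intertwines A f r d (\<phi> r d x) (\<phi>' r d x))"

text \<open>
  A Cartan relator is a choice, and an E-infinity map need not carry one choice into another. The
  constructions on its source and target can only be compared if the two choices correspond under
  the map. This is automatic for relators that come from the operad, \<open>H = \<phi> \<circ> K\<close>.
\<close>

definition relators_correspond ::
    "'a cplx \<Rightarrow> (nat \<Rightarrow> int \<Rightarrow> wres \<Rightarrow> 'a multimap) \<Rightarrow> (nat \<Rightarrow> int \<Rightarrow> wres \<Rightarrow> 'b multimap)
     \<Rightarrow> (int \<Rightarrow> 'a \<Rightarrow> 'b) \<Rightarrow> bool"
  where "relators_correspond A H H' f \<longleftrightarrow>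
    (\<forall>r>0. \<forall>n. \<forall>w\<in>chains (cmx W r) n. intertwines A f (2 * r) (n + 1) (H r n w) (H' r n w))"

definition induced_relator ::
    "'o::ab_group_add operad_data \<Rightarrow> (nat \<Rightarrow> int \<Rightarrow> wres \<Rightarrow> 'o) \<Rightarrow> (nat \<Rightarrow> int \<Rightarrow> 'o \<Rightarrow> 'a multimap)
     \<Rightarrow> (nat \<Rightarrow> int \<Rightarrow> wres \<Rightarrow> 'a multimap) \<Rightarrow> bool"
  where "induced_relator R K \<phi> H \<longleftrightarrow> C_graded_map 1 W (C_hat R) K
    \<and> (\<forall>r>0. \<forall>n. \<forall>w\<in>chains (cmx W r) n. H r n w = \<phi> (2 * r) (n + 1) (K r n w))"

end

theory Submission
  imports Defs
begin

text \<open>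
  Evaluate the homotopy identity of the Cartan relator on the generator \<open>e\<^sub>i\<close> and on the tensor
  \<open>X = a\<^sup>\<otimes>\<^sup>p \<otimes> b\<^sup>\<otimes>\<^sup>p\<close>. With the differential of \<open>Hom(A\<^bsup>\<otimes>2p\<^esup>, A)\<close> written out, it reads
  \<open>\<partial> H(e\<^sub>i)(X) = (-1)\<^bsup>i+1\<^esup> H(e\<^sub>i)(\<partial>X) - H(\<partial>e\<^sub>i)(X) + \<tau>F(e\<^sub>i)(X) - G(e\<^sub>i)(X)\<close>.
  Modulo \<open>p\<close> the first two terms on the right vanish and the other two give the lift of the Cartan
  formula.

  The term with \<open>\<partial>X\<close> vanishes because \<open>\<partial>a\<close> and \<open>\<partial>b\<close> are divisible by \<open>p\<close> and \<open>H(e\<^sub>i)\<close> is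
  multilinear (\<open>on_tensor_bd_pmult\<close>). For the others the point is that, \<open>p\<close> being odd, the cyclic
  group acts on \<open>a\<^sup>\<otimes>\<^sup>p\<close> without sign. Hence \<open>H(\<rho>\<^sup>s e\<^bsub>i-1\<^esub>)(X)\<close> does not depend on \<open>s\<close>, and
  \<open>H(\<partial>e\<^sub>i)(X)\<close> is either \<open>0\<close> or \<open>p\<close> times such a value (\<open>relator_W_bd\<close>). In \<open>G\<close>, each double sum
  over \<open>0 \<le> s < t < p\<close> that occurs in the coproduct of \<open>e\<^sub>i\<close>, for even \<open>i\<close>, consists of
  \<open>p (p - 1) / 2\<close> equal terms and vanishes modulo \<open>p\<close>; what is left is the sum of products in the
  Cartan formula (\<open>G_power_pair\<close>). Finally \<open>\<tau>F(e\<^sub>i)(X)\<close> is \<open>\<psi>\<^sub>i((a \<smile> b)\<^sup>\<otimes>\<^sup>p)\<close> up to the Koszul sign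
  of the shuffle (\<open>tauF_power_pair\<close>).

  Independence of the lifts of the mod \<open>p\<close> classes is multilinearity once more
  (\<open>multilinear_cong_pmult\<close>), and naturality is evaluation of the intertwining relation at \<open>X\<close>. For
  relators induced from the operad that relation is part of the definition of an E-infinity map.
\<close>

section \<open>Subgroups and integer multiples\<close>

definition add_subgroup :: "'a::ab_group_add set \<Rightarrow> bool"
  where "add_subgroup S \<longleftrightarrow> 0 \<in> S \<and> (\<forall>x\<in>S. \<forall>y\<in>S. x - y \<in> S)"

lemma add_subgroup_closed:
  assumes "add_subgroup S"
  shows "0 \<in> S" "x \<in> S \<Longrightarrow> y \<in> S \<Longrightarrow> x - y \<in> S" "x \<in> S \<Longrightarrow> - x \<in> S"
    "x \<in> S \<Longrightarrow> y \<in> S \<Longrightarrow> x + y \<in> S" "x \<in> S \<Longrightarrow> ksign k x \<in> S"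
proof -
  show zero: "0 \<in> S" using assms by (simp add: add_subgroup_def)
  show diff: "x - y \<in> S" if "x \<in> S" "y \<in> S" for x y using assms that by (simp add: add_subgroup_def)
  show minus: "- x \<in> S" if "x \<in> S" for x using diff[OF zero that] by simp
  show "x + y \<in> S" if "x \<in> S" "y \<in> S" using diff[OF that(1) minus[OF that(2)]] by simp
  show "ksign k x \<in> S" if "x \<in> S" using that minus by (simp add: ksign_def)
qed

lemma add_subgroup_sum:
  "add_subgroup S \<Longrightarrow> (\<And>i. i \<in> I \<Longrightarrow> g i \<in> S) \<Longrightarrow> sum g I \<in> S"
  by (induction I rule: infinite_finite_induct) (auto intro: add_subgroup_closed)

lemma additive_on_subgroup:
  assumes "add_subgroup S" "additive_on S f"
  shows "f 0 = 0" "x \<in> S \<Longrightarrow> y \<in> S \<Longrightarrow> f (x - y) = f x - f y"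
proof -
  note cl = add_subgroup_closed[OF assms(1)]
  have add: "f (x + y) = f x + f y" if "x \<in> S" "y \<in> S" for x y
    using assms(2) that by (simp add: additive_on_def)
  show "f (x - y) = f x - f y" if "x \<in> S" "y \<in> S"
    using add[OF cl(2)[OF that] that(2)] by (simp add: algebra_simps)
  show "f 0 = 0" using add[OF cl(1) cl(1)] by simp
qed

lemma additive_on_sum:
  assumes "add_subgroup S" "additive_on S f" "\<And>i. i \<in> I \<Longrightarrow> g i \<in> S"
  shows "f (sum g I) = (\<Sum>i\<in>I. f (g i))"
  using assms(3)
proof (induction I rule: infinite_finite_induct)
  case (insert i I)
  then show ?case
    using assms(2) add_subgroup_sum[OF assms(1), of I g] by (simp add: additive_on_def)
qed (simp_all add: additive_on_subgroup[OF assms(1,2)])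

lemma zmul_nat: "zmul (int m) x = (\<Sum>i<m. x)"
  by (simp add: zmul_def)

lemma zmul_add_one: "zmul (c + 1) x = zmul c x + x"
proof (cases "0 \<le> c")
  case True
  then have "nat (c + 1) = Suc (nat c)" by simp
  then show ?thesis using True by (simp add: zmul_def)
next
  case False
  then have "nat (- c) = Suc (nat (- (c + 1)))" "nat (c + 1) = 0" "nat c = 0" by simp_all
  then show ?thesis by (simp add: zmul_def)
qed

lemma zmul_0 [simp]: "zmul 0 x = 0" and zmul_1 [simp]: "zmul 1 x = x"
  and zmul_zero_right [simp]: "zmul c 0 = 0"
  by (simp_all add: zmul_def)

lemma zmul_add_left: "zmul (c + d) x = zmul c x + zmul d x"
proof (induction d rule: int_induct[where k = 0])
  case (step1 d)
  then show ?case
    using zmul_add_one[of "c + d" x] zmul_add_one[of d x] by (simp add: algebra_simps)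
next
  case (step2 d)
  then show ?case
    using zmul_add_one[of "c + (d - 1)" x] zmul_add_one[of "d - 1" x] by (simp add: algebra_simps)
qed simp

lemma zmul_diff_right: "zmul (int m) (x - y) = zmul (int m) x - zmul (int m) y"
  by (simp add: zmul_nat sum_subtractf)

lemma zmul_apply: "zmul c f x = zmul c (f x)"
  for f :: "'b \<Rightarrow> 'a::ab_group_add"
proof -
  have "(\<Sum>i<m. f) x = (\<Sum>i<m. f x)" for m :: nat by (induction m) auto
  then show ?thesis by (simp add: zmul_def)
qed

lemma sum_apply: "sum g I x = (\<Sum>i\<in>I. g i x)"
  for g :: "'i \<Rightarrow> 'b \<Rightarrow> 'a::ab_group_add"
  by (induction I rule: infinite_finite_induct) auto

lemma zmul_mult: "zmul (int (m * n)) x = zmul (int m) (zmul (int n) x)"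
proof (induction m)
  case (Suc m)
  have "int (Suc m * n) = int (m * n) + int n" "int (Suc m) = int m + 1"
    by (simp_all add: algebra_simps)
  then show ?case using Suc by (simp only: zmul_add_left zmul_1)
qed simp

lemma sum_constant_zmul: "(\<Sum>i\<in>I. x) = zmul (int (card I)) x"
  by (induction I rule: infinite_finite_induct)
     (simp_all add: zmul_add_one[of "int _"] add.commute[of 1])

lemma additive_on_zmul:
  assumes "add_subgroup S" "additive_on S f" "x \<in> S"
  shows "f (zmul (int m) x) = zmul (int m) (f x)"
  using additive_on_sum[OF assms(1,2), of "{..<m}" "\<lambda>_. x"] assms(3) by (simp add: zmul_nat)

section \<open>Linear extension from a basis\<close>

text \<open>
  The linear extension of \<open>V\<close> to chains with integer coefficients. The map \<open>G\<close> of the Cartan relation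
  is of this form, with the coproduct as argument, so that additivity in \<open>c\<close> splits it along the
  sums that define the coproduct.
\<close>

definition lin_eval :: "('k \<Rightarrow> 'b::ab_group_add) \<Rightarrow> ('k \<Rightarrow>\<^sub>0 int) \<Rightarrow> 'b"
  where "lin_eval V c = (\<Sum>k\<in>Poly_Mapping.keys c. zmul (Poly_Mapping.lookup c k) (V k))"

lemma lin_eval_superset:
  assumes "finite K" "Poly_Mapping.keys c \<subseteq> K"
  shows "lin_eval V c = (\<Sum>k\<in>K. zmul (Poly_Mapping.lookup c k) (V k))"
  unfolding lin_eval_def using assms
  by (intro sum.mono_neutral_left) (auto simp: in_keys_iff)

lemma lin_eval_frag_of [simp]: "lin_eval V (frag_of k) = V k"
  by (simp add: lin_eval_def)

lemma lin_eval_add: "lin_eval V (c + d) = lin_eval V c + lin_eval V d"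
proof -
  let ?K = "Poly_Mapping.keys c \<union> Poly_Mapping.keys d"
  have "lin_eval V e = (\<Sum>k\<in>?K. zmul (Poly_Mapping.lookup e k) (V k))"
    if "Poly_Mapping.keys e \<subseteq> ?K" for e
    using that by (intro lin_eval_superset) auto
  then show ?thesis
    using Poly_Mapping.keys_add[of c d] by (simp add: lookup_add zmul_add_left sum.distrib)
qed

lemma lin_eval_0 [simp]: "lin_eval V 0 = 0"
  by (simp add: lin_eval_def)

lemma lin_eval_sum: "lin_eval V (sum g I) = (\<Sum>i\<in>I. lin_eval V (g i))"
  by (induction I rule: infinite_finite_induct) (auto simp: lin_eval_add)

section \<open>Multilinear maps modulo p\<close>

lemma chains_subgroup: "chain_complex A \<Longrightarrow> add_subgroup (chains A n)"
  by (simp add: chain_complex_def add_subgroup_def)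

text \<open>
  The kernel of the reduction \<open>A \<rightarrow> A \<otimes> F\<^sub>p\<close> in degree \<open>n\<close>: all congruences below are
  stated as membership of a difference in this subgroup.
\<close>

definition pmult :: "nat \<Rightarrow> 'a::ab_group_add cplx \<Rightarrow> int \<Rightarrow> 'a set"
  where "pmult p A n = zmul (int p) ` chains A n"

lemma pmult_subgroup:
  assumes "chain_complex A" shows "add_subgroup (pmult p A n)"
proof -
  note cl = add_subgroup_closed[OF chains_subgroup[OF assms]]
  show ?thesis
    unfolding add_subgroup_def pmult_def
    using cl(1,2) by (auto simp: zmul_diff_right[symmetric] intro!: image_eqI[of 0 _ 0])
qed

lemma modp_eq_iff:
  assumes "chain_complex A"
  shows "modp p A n x = modp p A n y \<longleftrightarrow> x - y \<in> pmult p A n"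
proof -
  note cl = add_subgroup_closed[OF pmult_subgroup[OF assms, of p n]]
  have mem: "u \<in> modp p A n v \<longleftrightarrow> u - v \<in> pmult p A n" for u v
    by (auto simp: modp_def pmult_def image_iff algebra_simps)
  show ?thesis
  proof
    assume "modp p A n x = modp p A n y"
    then show "x - y \<in> pmult p A n" using mem[of x x] mem[of x y] cl(1) by simp
  next
    assume xy: "x - y \<in> pmult p A n"
    show "modp p A n x = modp p A n y"
    proof (rule set_eqI, unfold mem)
      fix w
      show "w - x \<in> pmult p A n \<longleftrightarrow> w - y \<in> pmult p A n"
        using cl(4)[OF _ xy, of "w - x"] cl(2)[OF _ xy, of "w - y"] by auto
    qed
  qed
qed

lemma homog_replicate:
  "homog (replicate r A) xs \<longleftrightarrow> length xs = r \<and> (\<forall>i<r. snd (xs ! i) \<in> chains A (fst (xs ! i)))"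
  by (auto simp: homog_def list_all2_conv_all_nth split_beta)

lemma tdeg_simps [simp]:
  "tdeg [] = 0" "tdeg (x # xs) = fst x + tdeg xs" "tdeg (xs @ ys) = tdeg xs + tdeg ys"
  "tdeg (replicate r x) = int r * fst x"
  by (simp_all add: tdeg_def sum_list_replicate)

lemma tdeg_update: "i < length xs \<Longrightarrow> tdeg (xs[i := x]) = tdeg xs - fst (xs ! i) + fst x"
  by (induction xs arbitrary: i) (auto simp: tdeg_def split: nat.split)

lemma multilinear_slot:
  assumes "multilinear (replicate r A) f" "homog (replicate r A) xs" "i < r"
  shows "additive_on (chains A n) (\<lambda>x. f (xs[i := (n, x)]))"
proof -
  have "length xs = r" using assms(2) by (simp add: homog_replicate)
  then show ?thesis
    using assms by (simp add: additive_on_def multilinear_def)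
qed

lemma End_chainsD:
  assumes "f \<in> chains (End_cplx A r) d"
  shows "multilinear (replicate r A) f"
    and "homog (replicate r A) xs \<Longrightarrow> f xs \<in> chains A (tdeg xs + d)"
  using assms by (auto simp: End_cplx_def)

lemma homog_update:
  assumes "homog (replicate r A) xs" "x \<in> chains A n"
  shows "homog (replicate r A) (xs[i := (n, x)])"
  using assms by (cases "i < length xs") (auto simp: homog_replicate nth_list_update list_update_beyond)

lemma multilinear_pmult_slot:
  assumes A: "chain_complex A" and f: "f \<in> chains (End_cplx A r) d"
    and xs: "homog (replicate r A) xs" and i: "i < r" and x: "x \<in> pmult p A n"
  shows "f (xs[i := (n, x)]) \<in> pmult p A (tdeg xs - fst (xs ! i) + n + d)"
proof -
  obtain z where z: "z \<in> chains A n" "x = zmul (int p) z"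
    using x by (auto simp: pmult_def)
  have "f (xs[i := (n, x)]) = zmul (int p) (f (xs[i := (n, z)]))"
    using additive_on_zmul[OF chains_subgroup[OF A] multilinear_slot[OF End_chainsD(1)[OF f] xs i] z(1)]
    by (simp add: z(2))
  moreover have "i < length xs" using xs i by (simp add: homog_replicate)
  ultimately show ?thesis
    using End_chainsD(2)[OF f homog_update[OF xs z(1), of i]]
    by (simp add: pmult_def tdeg_update)
qed

text \<open>
  The entries of \<open>xs\<close> are exchanged for those of \<open>ys\<close> one at a time. Each exchange alters the
  value by the value on a tensor with an entry divisible by \<open>p\<close>.
\<close>

lemma multilinear_cong_pmult:
  assumes A: "chain_complex A" and f: "f \<in> chains (End_cplx A r) d"
    and xs: "homog (replicate r A) xs" and ys: "homog (replicate r A) ys"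
    and cong: "\<And>i. i < r \<Longrightarrow> fst (xs ! i) = fst (ys ! i)
                        \<and> snd (xs ! i) - snd (ys ! i) \<in> pmult p A (fst (xs ! i))"
  shows "f xs - f ys \<in> pmult p A (tdeg xs + d)"
proof -
  have len: "length xs = r" "length ys = r" using xs ys by (simp_all add: homog_replicate)
  note cl = add_subgroup_closed[OF pmult_subgroup[OF A]]
  have "f xs - f (take k ys @ drop k xs) \<in> pmult p A (tdeg xs + d)" if "k \<le> r" for k
    using that
  proof (induction k)
    case 0
    show ?case by (simp add: cl)
  next
    case (Suc k)
    then have k: "k < r" by simp
    define zs where "zs = take k ys @ drop k xs"
    have lz: "length zs = r" using k len by (simp add: zs_def)
    have zs: "homog (replicate r A) zs"
      using xs ys k len by (auto simp: homog_replicate zs_def nth_append)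
    have fstz: "fst (zs ! j) = fst (xs ! j)" if "j < r" for j
      using cong[OF that] that len k by (simp add: zs_def nth_append)
    have "map fst zs = map fst xs" using fstz lz len by (intro nth_equalityI) auto
    then have deg: "tdeg zs = tdeg xs" by (simp add: tdeg_def)
    define n where "n = fst (xs ! k)"
    have xk: "xs ! k = (n, snd (xs ! k))" and yk: "ys ! k = (n, snd (ys ! k))"
      using cong[OF k] by (simp_all add: n_def prod_eq_iff)
    have mem: "snd (xs ! k) \<in> chains A n" "snd (ys ! k) \<in> chains A n"
      using xs ys k xk yk by (auto simp: homog_replicate) (metis fst_conv)+
    have zk: "zs ! k = xs ! k" using k len by (simp add: zs_def nth_append)
    have 1: "zs[k := (n, snd (xs ! k))] = zs"
      using xk zk by (metis list_update_id)
    have 2: "zs[k := (n, snd (ys ! k))] = take (Suc k) ys @ drop (Suc k) xs"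
      using yk k len by (auto simp: zs_def list_update_append take_Suc_conv_app_nth Cons_nth_drop_Suc[symmetric])
    have "f zs - f (take (Suc k) ys @ drop (Suc k) xs) = f (zs[k := (n, snd (xs ! k) - snd (ys ! k))])"
      using additive_on_subgroup(2)[OF chains_subgroup[OF A] multilinear_slot[OF End_chainsD(1)[OF f] zs k] mem]
      by (simp add: 1 2)
    also have "\<dots> \<in> pmult p A (tdeg zs - fst (zs ! k) + n + d)"
      using cong[OF k] by (intro multilinear_pmult_slot[OF A f zs k]) (metis n_def)
    finally have "f zs - f (take (Suc k) ys @ drop (Suc k) xs) \<in> pmult p A (tdeg xs + d)"
      by (simp add: deg zk n_def)
    from cl(4)[OF Suc.IH[folded zs_def] this] k show ?case by (simp add: zs_def)
  qed
  from this[of r] len show ?thesis by simp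
qed

text \<open>
  Every summand of the boundary of the tensor has one entry that is the boundary of a mod \<open>p\<close> cycle
  and hence divisible by \<open>p\<close>. This is the reason why the internal part of the differential of
  \<open>Hom(A\<^sup>\<otimes>\<^sup>r, A)\<close> disappears modulo \<open>p\<close>.
\<close>

lemma on_tensor_bd_pmult:
  assumes A: "chain_complex A" and f: "f \<in> chains (End_cplx A r) d"
    and xs: "homog (replicate r A) xs"
    and cyc: "\<And>i. i < r \<Longrightarrow> modp_cycle p A (xs ! i)"
  shows "on_tensor_bd (replicate r A) f xs \<in> pmult p A (tdeg xs + d - 1)"
  unfolding on_tensor_bd_def
proof (intro add_subgroup_sum[OF pmult_subgroup[OF A]] add_subgroup_closed(5)[OF pmult_subgroup[OF A]])
  fix i assume "i \<in> {..<length xs}"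
  then have i: "i < r" using xs by (simp add: homog_replicate)
  have "bd A (fst (xs ! i)) (snd (xs ! i)) \<in> pmult p A (fst (xs ! i) - 1)"
    using cyc[OF i] modp_eq_iff[OF A, of p _ _ 0] by (auto simp: modp_cycle_def split_beta)
  from multilinear_pmult_slot[OF A f xs i this]
  show "f (xs[i := (fst (xs ! i) - 1,
          bd (replicate r A ! i) (fst (xs ! i)) (snd (xs ! i)))]) \<in> pmult p A (tdeg xs + d - 1)"
    using i by (simp add: algebra_simps)
qed

section \<open>Rotations, the shuffle and their Koszul signs\<close>

lemma permutes_endo:
  assumes "finite S" "inj_on \<sigma> S" "\<And>l. l \<in> S \<Longrightarrow> \<sigma> l \<in> S" "\<And>l. l \<notin> S \<Longrightarrow> \<sigma> l = l"
  shows "\<sigma> permutes S"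
  using assms endo_inj_surj[of S \<sigma>] by (intro bij_imp_permutes) (auto simp: bij_betw_def)

lemma rot_eq: "rot r l = (if Suc l < r then Suc l else if Suc l = r then 0 else l)"
  by (auto simp: rot_def)

lemma rot_permutes: "rot r permutes {..<r}"
  by (rule permutes_endo) (auto simp: rot_eq inj_on_def split: if_splits)

lemma tau_permutes: "tau r permutes {..<2 * r}"
proof (rule permutes_endo)
  show "inj_on (tau r) {..<2 * r}" by (auto simp: tau_def inj_on_def split: if_splits) presburger+
qed (auto simp: tau_def)

lemma perm_sum_two:
  "perm_sum [m, n] [\<sigma>, \<pi>] l = (if l < m then \<sigma> l else if l < m + n then m + \<pi> (l - m) else l)"
  by auto

lemma perm_sum_two_permutes:
  assumes "\<sigma> permutes {..<m}" "\<pi> permutes {..<n}"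
  shows "perm_sum [m, n] [\<sigma>, \<pi>] permutes {..<m + n}"
proof (rule permutes_endo)
  have \<sigma>: "\<sigma> l < m" if "l < m" for l using permutes_in_image[OF assms(1), of l] that by simp
  have \<pi>: "\<pi> l < n" if "l < n" for l using permutes_in_image[OF assms(2), of l] that by simp
  show "inj_on (perm_sum [m, n] [\<sigma>, \<pi>]) {..<m + n}"
  proof (rule inj_onI)
    fix k l assume "k \<in> {..<m + n}" "l \<in> {..<m + n}"
      and eq: "perm_sum [m, n] [\<sigma>, \<pi>] k = perm_sum [m, n] [\<sigma>, \<pi>] l"
    moreover have "\<sigma> k = \<sigma> l \<longleftrightarrow> k = l" "\<pi> (k - m) = \<pi> (l - m) \<longleftrightarrow> k - m = l - m"
      using assms by (auto simp: inj_eq permutes_inj)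
    ultimately show "k = l"
      using \<sigma>[of k] \<sigma>[of l] unfolding perm_sum_two
      by (cases "k < m"; cases "l < m") simp_all
  qed
  show "perm_sum [m, n] [\<sigma>, \<pi>] l \<in> {..<m + n}" if "l \<in> {..<m + n}" for l
    using that \<sigma>[of l] \<pi>[of "l - m"] unfolding perm_sum_two by auto
  show "perm_sum [m, n] [\<sigma>, \<pi>] l = l" if "l \<notin> {..<m + n}" for l
    using that unfolding perm_sum_two by auto
qed simp

lemma permute_list_inv_eqI:
  assumes "\<sigma> permutes {..<n}" "length xs = n" "length ys = n" "\<And>i. i < n \<Longrightarrow> ys ! \<sigma> i = xs ! i"
  shows "permute_list (inv \<sigma>) xs = ys"
proof (rule nth_equalityI)
  fix i assume "i < length (permute_list (inv \<sigma>) xs)"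
  then have i: "i < n" using assms by simp
  have "inv \<sigma> i < n" using permutes_in_image[OF permutes_inv[OF assms(1)], of i] i by simp
  then show "permute_list (inv \<sigma>) xs ! i = ys ! i"
    using assms(4)[of "inv \<sigma> i"] permutes_inverses(1)[OF assms(1)] i assms(2)
    by (simp add: permute_list_def)
qed (use assms in simp)

lemma ksign_even_cong: "even k \<longleftrightarrow> even l \<Longrightarrow> ksign k = ksign l"
  by (simp add: ksign_def fun_eq_iff)

text \<open>
  The rotation carries the last factor past the \<open>r - 1\<close> others, so for odd \<open>r\<close> its sign is
  trivial on a tensor power.
\<close>

lemma koszul_exp_rot: "koszul_exp (rot r) (replicate r m) = int (r - 1) * (m * m)"
proof -
  have inversions: "{(i, j). i < j \<and> j < r \<and> rot r j < rot r i} = {..<r - 1} \<times> {r - 1}"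
    by (auto simp: rot_eq split: if_splits)
  have "koszul_exp (rot r) (replicate r m) = (\<Sum>x\<in>{..<r - 1} \<times> {r - 1}. m * m)"
    unfolding koszul_exp_def length_replicate inversions by (rule sum.cong) auto
  then show ?thesis by simp
qed

text \<open>
  A permutation that preserves the two blocks has no inversion between them.
\<close>

lemma koszul_exp_perm_sum:
  assumes "\<sigma> permutes {..<m}" "length ds = m" "length es = n"
  shows "koszul_exp (perm_sum [m, n] [\<sigma>, \<pi>]) (ds @ es) = koszul_exp \<sigma> ds + koszul_exp \<pi> es"
proof -
  have \<sigma>: "\<sigma> l < m" if "l < m" for l using permutes_in_image[OF assms(1), of l] that by simp
  let ?I = "{(i, j). i < j \<and> j < m \<and> \<sigma> j < \<sigma> i}" and ?J = "{(i, j). i < j \<and> j < n \<and> \<pi> j < \<pi> i}"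
  let ?s = "\<lambda>(i, j). (m + i, m + j)"
  have fin: "finite ?I" "finite ?J"
    by (rule finite_subset[of _ "{..<m} \<times> {..<m}"] finite_subset[of _ "{..<n} \<times> {..<n}"]; force)+
  have inj: "inj_on ?s ?J" by (auto simp: inj_on_def)
  have inversions: "{(i, j). i < j \<and> j < m + n \<and> perm_sum [m, n] [\<sigma>, \<pi>] j < perm_sum [m, n] [\<sigma>, \<pi>] i} = ?I \<union> ?s ` ?J"
    (is "?L = _")
  proof (rule set_eqI, clarify)
    fix i j
    show "(i, j) \<in> ?L \<longleftrightarrow> (i, j) \<in> ?I \<union> ?s ` ?J"
    proof (cases "i < m")
      case True
      then show ?thesis using \<sigma>[OF True] unfolding perm_sum_two by auto
    next
      case False
      then obtain i' where i': "i = m + i'" by (metis le_Suc_ex not_less)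
      show ?thesis
      proof (cases "j < m")
        case True
        then show ?thesis using i' by auto
      next
        case False
        then obtain j' where "j = m + j'" by (metis le_Suc_ex not_less)
        with i' show ?thesis unfolding perm_sum_two by (auto simp: image_iff)
      qed
    qed
  qed
  let ?G = "\<lambda>(i, j). (ds @ es) ! i * (ds @ es) ! j"
  have "koszul_exp (perm_sum [m, n] [\<sigma>, \<pi>]) (ds @ es) = sum ?G (?I \<union> ?s ` ?J)"
    unfolding koszul_exp_def length_append assms(2,3) inversions ..
  also have "\<dots> = sum ?G ?I + sum ?G (?s ` ?J)"
    using fin by (intro sum.union_disjoint) auto
  also have "sum ?G ?I = koszul_exp \<sigma> ds"
    unfolding koszul_exp_def assms(2) by (rule sum.cong) (auto simp: nth_append assms(2))
  also have "sum ?G (?s ` ?J) = koszul_exp \<pi> es"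
    unfolding koszul_exp_def assms(3) sum.reindex[OF inj]
    by (rule sum.cong) (auto simp: nth_append assms(2))
  finally show ?thesis .
qed

lemma card_pairs: "card {(s, t). s < t \<and> t < r} = r * (r - 1) div 2"
proof -
  have "{(s, t). s < t \<and> t < r} = prod.swap ` (SIGMA t:{..<r}. {..<t})" by force
  then have "card {(s, t). s < t \<and> t < r} = (\<Sum>t<r. t)"
    by (simp add: card_image)
  then show ?thesis using Sum_Ico_nat[of 0 r] by (simp add: lessThan_atLeast0)
qed

lemma card_pairs_odd: "odd r \<Longrightarrow> card {(s, t). s < t \<and> t < r} = r * (r div 2)"
  unfolding card_pairs by (auto elim!: oddE)

text \<open>
  The inversions of \<open>tau\<close> are the pairs of an entry \<open>a\<close> in place \<open>t\<close> and an entry \<open>b\<close> in place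
  \<open>s < t\<close> of its block, because the shuffle puts such a \<open>b\<close> in front of \<open>a\<close>.
\<close>

lemma koszul_exp_tau:
  "koszul_exp (tau r) (replicate r m @ replicate r n) = int (card {(s, t). s < t \<and> t < r}) * (m * n)"
proof -
  let ?I = "{(s, t). s < t \<and> t < r}"
  let ?f = "\<lambda>(s, t). (t, r + s)"
  have inj: "inj_on ?f ?I" by (auto simp: inj_on_def)
  have inversions: "{(i, j). i < j \<and> j < r + r \<and> tau r j < tau r i} = ?f ` ?I"
  proof (rule set_eqI, clarify)
    fix i j
    show "(i, j) \<in> {(i, j). i < j \<and> j < r + r \<and> tau r j < tau r i} \<longleftrightarrow> (i, j) \<in> ?f ` ?I"
      by (auto simp: tau_def image_iff intro!: exI[of _ "j - r"])
  qed
  have "koszul_exp (tau r) (replicate r m @ replicate r n) = (\<Sum>x\<in>?I. m * n)"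
    unfolding koszul_exp_def length_append length_replicate inversions sum.reindex[OF inj]
    by (rule sum.cong) (auto simp: nth_append)
  then show ?thesis by simp
qed

section \<open>Cyclic invariance on tensor powers\<close>

lemma power_pair_homog:
  assumes "snd a \<in> chains A (fst a)" "snd b \<in> chains A (fst b)"
  shows "homog (replicate (2 * r) A) (replicate r a @ replicate r b)"
  using assms by (auto simp: homog_replicate nth_append)

lemma End_rot_power:
  assumes "odd r"
  shows "opact (End_operad A) r n (rot r) f (replicate r a) = f (replicate r a)"
proof -
  have "permute_list (inv (rot r)) (replicate r a) = replicate r a"
    by (rule permute_list_inv_eqI[OF rot_permutes]) (auto simp: rot_eq)
  moreover have "even (r - 1)" using assms by simp
  ultimately show ?thesis
    by (simp add: End_operad_def koszul_exp_rot ksign_def)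
qed

lemma End_hat_rot_power:
  assumes "odd r"
  shows "crho (C_hat (End_operad A)) r n f (replicate r a @ replicate r b) = f (replicate r a @ replicate r b)"
proof -
  let ?\<sigma> = "perm_sum [r, r] [rot r, rot r]"
  have "permute_list (inv ?\<sigma>) (replicate r a @ replicate r b) = replicate r a @ replicate r b"
    by (rule permute_list_inv_eqI[OF perm_sum_two_permutes[OF rot_permutes rot_permutes]])
       (unfold perm_sum_two, auto simp: rot_eq nth_append)
  moreover have "even (int (r - 1))" using assms by simp
  ultimately show ?thesis
    by (simp add: End_operad_def C_hat_def koszul_exp_perm_sum[OF rot_permutes] koszul_exp_rot ksign_def
             del: perm_sum.simps)
qed

lemma W_frag_of_chains [simp]: "frag_of (n, s) \<in> chains (cmx W r) (int n) \<longleftrightarrow> s < r"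
  by (simp add: W_def)

lemma W_chains_subgroup: "add_subgroup (chains (cmx W r) k)"
  using Poly_Mapping.keys_diff by (fastforce simp: add_subgroup_def W_def)

text \<open>
  Here \<open>T\<close> is a functional, such as evaluation at a tensor power, that does not see the cyclic
  action. An equivariant map then looks the same to \<open>T\<close> on all translates of a generator.
\<close>

lemma C_graded_map_rotate:
  assumes f: "C_graded_map d W N f" and "s < r"
    and inv: "\<And>x. x \<in> chains (cmx N r) (int n + d) \<Longrightarrow> T (crho N r (int n + d) x) = T x"
  shows "T (f r (int n) (frag_of (n, s))) = T (f r (int n) (wgen n))"
  using \<open>s < r\<close>
proof (induction s)
  case 0
  show ?case by (simp add: wgen_def)
next
  case (Suc s)
  have mem: "frag_of (n, s) \<in> chains (cmx W r) (int n)" using Suc.prems by simp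
  have "frag_of (n, Suc s) = crho W r (int n) (frag_of (n, s))"
    using Suc.prems by (simp add: W_def wb_def)
  then have "f r (int n) (frag_of (n, Suc s)) = crho N r (int n + d) (f r (int n) (frag_of (n, s)))"
    using f mem Suc.prems by (simp add: C_graded_map_def)
  moreover have "f r (int n) (frag_of (n, s)) \<in> chains (cmx N r) (int n + d)"
    using f mem Suc.prems by (simp add: C_graded_map_def graded_map_def)
  ultimately show ?case using Suc inv by simp
qed

lemma C_graded_map_chains:
  assumes "C_graded_map d W N f" "0 < r"
  shows "f r (int n) (wgen n) \<in> chains (cmx N r) (int n + d)"
  using assms W_frag_of_chains[of n 0 r] by (simp add: C_graded_map_def graded_map_def wgen_def)

section \<open>The relator on the boundary of a generator\<close>

text \<open>
  Modulo the cyclic action, \<open>\<partial>e\<^sub>n\<close> is \<open>0\<close> for odd \<open>n\<close> and \<open>r e\<^bsub>n-1\<^esub>\<close> for even \<open>n > 0\<close>. Evaluation at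
  \<open>a\<^sup>\<otimes>\<^sup>r \<otimes> b\<^sup>\<otimes>\<^sup>r\<close> is invariant under the cyclic action because \<open>r\<close> is odd.
\<close>

lemma relator_W_bd:
  assumes A: "chain_complex A" and H: "C_graded_map 1 W (C_hat (End_operad A)) H" and "odd r"
    and a: "snd a \<in> chains A (fst a)" and b: "snd b \<in> chains A (fst b)"
  shows "H r (int n - 1) (bd (cmx W r) (int n) (wgen n)) (replicate r a @ replicate r b)
         \<in> pmult r A (int r * (fst a + fst b) + int n)"
proof -
  let ?X = "replicate r a @ replicate r b"
  note cl = add_subgroup_closed[OF pmult_subgroup[OF A]]
  have r: "0 < r" using \<open>odd r\<close> by (rule odd_pos)
  have add: "additive_on (chains (cmx W r) k) (H r k)" for k
    using H r by (simp add: C_graded_map_def graded_map_def)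
  note lin = additive_on_subgroup[OF W_chains_subgroup add]
  have bd: "bd (cmx W r) (int n) (wgen n) = W_bd_basis r (n, 0)"
    by (simp add: W_def wgen_def)
  have "H r (int n - 1) (W_bd_basis r (n, 0)) ?X \<in> pmult r A (int r * (fst a + fst b) + int n)"
  proof (cases n)
    case 0
    then show ?thesis by (simp add: W_bd_basis_def cl lin(1))
  next
    case (Suc m)
    let ?h = "H r (int m) (wgen m) ?X"
    have mem: "wb r s m \<in> chains (cmx W r) (int m)" for s using r by (simp add: wb_def)
    have rot: "H r (int m) (wb r s m) ?X = ?h" for s
      unfolding wb_def using r
      by (intro C_graded_map_rotate[OF H, where T = "\<lambda>f. f ?X"]) (auto simp: End_hat_rot_power[OF \<open>odd r\<close>])
    show ?thesis
    proof (cases "odd n")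
      case True
      then have "H r (int n - 1) (W_bd_basis r (n, 0)) ?X = 0"
        using lin(2)[OF mem mem] rot by (simp add: W_bd_basis_def Suc)
      then show ?thesis by (simp add: cl)
    next
      case False
      then have "W_bd_basis r (n, 0) = (\<Sum>u<r. wb r u m)" by (simp add: W_bd_basis_def Suc)
      then have "H r (int n - 1) (W_bd_basis r (n, 0)) ?X = (\<Sum>u<r. H r (int m) (wb r u m) ?X)"
        by (simp add: Suc sum_apply additive_on_sum[OF W_chains_subgroup add] mem)
      also have "\<dots> = zmul (int r) ?h" by (simp add: rot zmul_nat)
      moreover have "?h \<in> chains A (tdeg ?X + (int m + 1))"
        using C_graded_map_chains[OF H r, of m] power_pair_homog[OF a b]
        by (intro End_chainsD(2)) (simp_all add: C_hat_def End_operad_def)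
      ultimately show ?thesis by (simp add: pmult_def Suc algebra_simps)
    qed
  qed
  then show ?thesis by (simp only: bd)
qed

section \<open>The two sides of the Cartan relation on tensor powers\<close>

lemma nth_alternating:
  "l < r \<Longrightarrow> concat (replicate r [a, b]) ! (2 * l) = a \<and> concat (replicate r [a, b]) ! Suc (2 * l) = b"
proof (induction r arbitrary: l)
  case (Suc r)
  then show ?case by (cases l) auto
qed simp

lemma length_alternating: "length (concat (replicate r [a, b])) = 2 * r"
  by (induction r) auto

lemma blocks_alternating: "blocks (replicate r 2) (concat (replicate r [a, b])) = replicate r [a, b]"
  by (induction r) (auto simp: numeral_2_eq_2)

lemma shuffle_exp_zeros: "shuffle_exp (replicate r 0) es = 0"
  by (simp add: shuffle_exp_def)

text \<open>
  The shuffle turns \<open>a\<^sup>\<otimes>\<^sup>r \<otimes> b\<^sup>\<otimes>\<^sup>r\<close> into \<open>(a \<otimes> b)\<^sup>\<otimes>\<^sup>r\<close> with the sign of \<open>r (r div 2)\<close> exchanges of an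
  \<open>a\<close> with a \<open>b\<close>. This sign is that of \<open>r div 2\<close> exchanges, as \<open>r\<close> is odd.
\<close>

lemma tauF_power_pair:
  assumes "odd r" and a: "snd a \<in> chains A (fst a)" and b: "snd b \<in> chains A (fst b)"
  shows "cartan_tauF (End_operad A) \<psi> r n w (replicate r a @ replicate r b)
         = ksign (int (r div 2) * fst a * fst b) (\<psi> r n w (replicate r (smile \<psi> a b)))"
proof -
  let ?Y = "concat (replicate r [a, b])"
  have perm: "permute_list (inv (tau r)) (replicate r a @ replicate r b) = ?Y"
  proof (rule permute_list_inv_eqI[OF tau_permutes])
    fix i assume "i < 2 * r"
    then show "?Y ! tau r i = (replicate r a @ replicate r b) ! i"
      using nth_alternating[of i r a b] nth_alternating[of "i - r" r a b]
      by (auto simp: tau_def nth_append)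
  qed (simp_all add: length_alternating)
  have "set ?Y \<subseteq> {a, b}" by (induction r) auto
  have "homog (replicate (r * 2) A) ?Y"
    unfolding homog_replicate
  proof (intro conjI allI impI)
    fix i assume "i < r * 2"
    then have "?Y ! i \<in> set ?Y" by (intro nth_mem) (simp add: length_alternating)
    with \<open>set ?Y \<subseteq> {a, b}\<close> have "?Y ! i = a \<or> ?Y ! i = b" by blast
    then show "snd (?Y ! i) \<in> chains A (fst (?Y ! i))" using a b by metis
  qed (simp add: length_alternating)
  then have "cartan_F (End_operad A) \<psi> r n w ?Y = \<psi> r n w (replicate r (smile \<psi> a b))"
    by (simp add: cartan_F_def End_operad_def End_comp_def sum_list_replicate blocks_alternating
          shuffle_exp_zeros ksign_def zip_replicate smile_def map_replicate)
  moreover have "ksign (koszul_exp (tau r) (replicate r (fst a) @ replicate r (fst b)))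
      = (ksign (int (r div 2) * fst a * fst b) :: 'a \<Rightarrow> 'a)"
    using \<open>odd r\<close> by (intro ksign_even_cong) (simp add: koszul_exp_tau card_pairs_odd)
  ultimately show ?thesis
    by (simp add: cartan_tauF_def End_operad_def perm)
qed

lemma psi_power_chains:
  assumes \<psi>: "C_graded_map 0 W (C_restrict (End_operad A)) \<psi>" and "0 < r"
    and a: "snd a \<in> chains A (fst a)"
  shows "snd (psi_power \<psi> r k a) \<in> chains A (fst (psi_power \<psi> r k a))"
  using End_chainsD(2)[of "\<psi> r (int k) (wgen k)" A r "int k" "replicate r a"]
    C_graded_map_chains[OF \<psi> \<open>0 < r\<close>, of k] a
  by (simp add: psi_power_def C_restrict_def End_operad_def homog_replicate)

lemma smile_chains:
  assumes \<psi>: "C_graded_map 0 W (C_restrict (End_operad A)) \<psi>"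
    and x: "snd x \<in> chains A (fst x)" and y: "snd y \<in> chains A (fst y)"
  shows "snd (smile \<psi> x y) \<in> chains A (fst x + fst y)"
  using End_chainsD(2)[of "\<psi> 2 0 (wgen 0)" A 2 0 "[x, y]"] C_graded_map_chains[OF \<psi>, of 2 0] x y
  by (simp add: smile_def C_restrict_def End_operad_def homog_replicate less_2_cases_iff)

text \<open>
  The sign comes from moving the second operation, of degree \<open>l\<close>, past \<open>a\<^sup>\<otimes>\<^sup>r\<close>, of degree
  \<open>r |a|\<close>. The rotations in the two factors have no effect on the value, so all terms of the
  coproduct with the same \<open>k\<close> and \<open>l\<close> agree.
\<close>

lemma smile_power_pair:
  assumes \<psi>: "C_graded_map 0 W (C_restrict (End_operad A)) \<psi>" and "odd r" "s < r" "t < r"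
    and a: "snd a \<in> chains A (fst a)" and b: "snd b \<in> chains A (fst b)"
  shows "opcomp (End_operad A) [r, r] (0, \<psi> 2 0 (wgen 0))
           [(int k, \<psi> r (int k) (frag_of (k, s))), (int l, \<psi> r (int l) (frag_of (l, t)))]
           (replicate r a @ replicate r b)
         = ksign (int l * fst a) (snd (smile \<psi> (psi_power \<psi> r k a) (psi_power \<psi> r l b)))"
proof -
  have rot: "\<psi> r (int k) (frag_of (k, s)) (replicate r c) = \<psi> r (int k) (wgen k) (replicate r c)"
    if "s < r" for k s c
    using End_rot_power[OF \<open>odd r\<close>]
    by (intro C_graded_map_rotate[OF \<psi> that, where T = "\<lambda>f. f (replicate r c)"])
       (simp add: C_restrict_def)
  have homog: "homog (replicate (r + r) A) (replicate r a @ replicate r b)"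
    using power_pair_homog[OF a b, of r] by (simp add: mult_2)
  have "ksign (int l * (int r * fst a)) = (ksign (int l * fst a) :: 'a \<Rightarrow> 'a)"
    using \<open>odd r\<close> by (intro ksign_even_cong) simp
  then show ?thesis
    using homog \<open>s < r\<close> \<open>t < r\<close>
    by (simp add: End_operad_def End_comp_def shuffle_exp_def smile_def psi_power_def rot
          lessThan_Suc add.commute)
qed

text \<open>
  In even degree the coproduct has further terms \<open>\<rho>\<^sup>s e\<^bsub>2j+1\<^esub> \<otimes> \<rho>\<^sup>t e\<^bsub>2k+1\<^esub>\<close> with \<open>s < t < r\<close>, which
  have no counterpart in the Cartan formula. For fixed \<open>j\<close> and \<open>k\<close> they all take the same value, and
  their number \<open>r (r - 1) / 2\<close> is a multiple of \<open>r\<close>. The remaining terms are exactly those that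
  are subtracted in the Cartan formula.
  The first term below is there to cancel the leading term of \<open>cartan_C\<close>.
\<close>

lemma G_power_pair:
  assumes A: "chain_complex A" and \<psi>: "C_graded_map 0 W (C_restrict (End_operad A)) \<psi>" and "odd r"
    and a: "snd a \<in> chains A (fst a)" and b: "snd b \<in> chains A (fst b)"
  shows "ksign (int (r div 2) * fst a * fst b) (snd (psi_power \<psi> r n (smile \<psi> a b)))
         - cartan_G (End_operad A) \<psi> r (int n) (wgen n) (replicate r a @ replicate r b)
         - cartan_C \<psi> r n a b \<in> pmult r A (int r * (fst a + fst b) + int n)"
proof -
  let ?X = "replicate r a @ replicate r b"
  define v where "v k l = snd (smile \<psi> (psi_power \<psi> r k a) (psi_power \<psi> r l b))" for k l
  define V where "V = (\<lambda>((k, s), (l, t)). opcomp (End_operad A) [r, r] (0, \<psi> 2 0 (wgen 0))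
           [(int k, \<psi> r (int k) (frag_of (k, s))), (int l, \<psi> r (int l) (frag_of (l, t)))] ?X)"
  note cl = add_subgroup_closed[OF pmult_subgroup[OF A]]
  have r: "0 < r" using \<open>odd r\<close> by (rule odd_pos)
  have V: "lin_eval V (wb2 r s k t l) = ksign (int l * fst a) (v k l)" for s k t l
    using smile_power_pair[OF \<psi> \<open>odd r\<close> _ _ a b, of "s mod r" "t mod r" k l] r
    by (simp add: wb2_def V_def v_def)
  have G: "cartan_G (End_operad A) \<psi> r (int n) (wgen n) ?X = lin_eval V (W_coprod_basis r (n, 0))"
    by (simp add: cartan_G_def lin_eval_def V_def W_coprod_def wgen_def sum_apply zmul_apply
          case_prod_unfold)
  have v_chains: "v k l \<in> chains A (int r * (fst a + fst b) + int (k + l))" for k l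
    using smile_chains[OF \<psi> psi_power_chains[OF \<psi> r a, of k] psi_power_chains[OF \<psi> r b, of l]]
    by (simp add: v_def psi_power_def algebra_simps)
  show ?thesis
  proof (cases "even n")
    case True
    let ?I = "{(s, t). s < t \<and> t < r}" and ?K = "{(j, k). j + k + 1 = n div 2}"
    let ?u = "\<lambda>j k. ksign (int (2 * k + 1) * fst a) (v (2 * j + 1) (2 * k + 1))"
    have "lin_eval V (W_coprod_basis r (n, 0))
        = (\<Sum>(j, k)\<in>{(j, k). j + k = n div 2}. v (2 * j) (2 * k))
          + (\<Sum>(j, k)\<in>?K. \<Sum>(s, t)\<in>?I. ?u j k)"
      using True by (simp add: W_coprod_basis_def Let_def lin_eval_add lin_eval_sum case_prod_unfold V)
         (simp add: ksign_def)
    moreover have "(\<Sum>(s, t)\<in>?I. ?u j k) \<in> pmult r A (int r * (fst a + fst b) + int n)"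
      if "j + k + 1 = n div 2" for j k
    proof -
      have "(\<Sum>(s, t)\<in>?I. ?u j k) = zmul (int (card ?I)) (?u j k)"
        unfolding sum_constant_zmul[symmetric] by (rule sum.cong) auto
      also have "\<dots> = zmul (int r) (zmul (int (r div 2)) (?u j k))"
        by (simp only: card_pairs_odd[OF \<open>odd r\<close>] zmul_mult)
      finally have "(\<Sum>(s, t)\<in>?I. ?u j k) = zmul (int r) (zmul (int (r div 2)) (?u j k))" .
      moreover have deg: "2 * j + 1 + (2 * k + 1) = n" using that True by auto
      have "zmul (int (r div 2)) (?u j k) \<in> chains A (int r * (fst a + fst b) + int n)"
        using v_chains[of "2 * j + 1" "2 * k + 1"] chains_subgroup[OF A] unfolding deg zmul_nat
        by (intro add_subgroup_sum add_subgroup_closed(5))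
      ultimately show ?thesis by (simp add: pmult_def)
    qed
    then have "(\<Sum>(j, k)\<in>?K. \<Sum>(s, t)\<in>?I. ?u j k) \<in> pmult r A (int r * (fst a + fst b) + int n)"
      by (intro add_subgroup_sum[OF pmult_subgroup[OF A]]) auto
    ultimately show ?thesis
      using True cl(3) by (simp add: G cartan_C_def v_def)
  next
    case False
    have "lin_eval V (W_coprod_basis r (n, 0))
        = (\<Sum>(j, k)\<in>{(j, k). j + k = n div 2}.
             v (2 * j + 1) (2 * k) + ksign (fst a) (v (2 * j) (2 * k + 1)))"
      using False
      by (simp add: W_coprod_basis_def Let_def lin_eval_add lin_eval_sum case_prod_unfold V)
         (simp add: ksign_def add.commute)
    then show ?thesis using False cl(1) by (simp add: G cartan_C_def v_def)
  qed
qed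

section \<open>The Cartan boundary construction\<close>

lemma May_Steenrod_psi:
  assumes "May_Steenrod R A \<phi> \<iota>"
  shows "C_graded_map 0 W (C_restrict (End_operad A)) (psi_of \<phi> \<iota>)"
proof -
  have \<phi>: "chain_map (opc R r) (opc (End_operad A) r) (\<phi> r)"
      "x \<in> chains (opc R r) n \<Longrightarrow>
         \<phi> r n (opact R r n (rot r) x) = opact (End_operad A) r n (rot r) (\<phi> r n x)"
    if "0 < r" for r n x
    using assms that rot_permutes by (auto simp: May_Steenrod_def operad_morphism_def)
  have \<iota>: "C_graded_map 0 W (C_restrict R) \<iota>"
    using assms by (simp add: May_Steenrod_def C_quasi_iso_def)
  have \<iota>_chains: "\<iota> r n x \<in> chains (opc R r) n" if "0 < r" "x \<in> chains (cmx W r) n" for r n x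
    using \<iota> that by (simp add: C_graded_map_def graded_map_def C_restrict_def)
  show ?thesis
    unfolding C_graded_map_def
  proof (intro allI impI conjI ballI)
    fix r :: nat assume r: "0 < r"
    show "graded_map 0 (cmx W r) (cmx (C_restrict (End_operad A)) r) (psi_of \<phi> \<iota> r)"
      using \<phi>(1)[OF r] \<iota> \<iota>_chains[OF r] r
      by (simp add: graded_map_def chain_map_def C_graded_map_def additive_on_def psi_of_def C_restrict_def)
    show "psi_of \<phi> \<iota> r n (crho W r n x) = crho (C_restrict (End_operad A)) r (n + 0) (psi_of \<phi> \<iota> r n x)"
      if "x \<in> chains (cmx W r) n" for n x
      using \<phi>(2)[OF r \<iota>_chains[OF r that]] \<iota> r that
      by (simp add: C_graded_map_def psi_of_def C_restrict_def)
  qed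
qed

lemma relator_generator_chains:
  assumes "C_graded_map 1 W (C_hat (End_operad A)) H" "0 < r"
  shows "H r (int n) (wgen n) \<in> chains (End_cplx A (2 * r)) (int n + 1)"
  using C_graded_map_chains[OF assms, of n] by (simp add: C_hat_def End_operad_def)

lemma modp_cycle_chains: "modp_cycle p A a \<Longrightarrow> snd a \<in> chains A (fst a)"
  by (auto simp: modp_cycle_def)

lemma tdeg_power_pair: "tdeg (replicate p a @ replicate p b) + (int i + 1) = zeta_deg p i a b"
  by (simp add: zeta_deg_def algebra_simps)

text \<open>
  The homotopy identity of the relator, applied to \<open>e\<^sub>i\<close> and evaluated at
  \<open>a\<^sup>\<otimes>\<^sup>p \<otimes> b\<^sup>\<otimes>\<^sup>p\<close>, consists of the boundary of \<open>\<zeta>\<^sub>i(a, b)\<close>, the value on the boundary of the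
  tensor, the relator on \<open>\<partial>e\<^sub>i\<close> and the two sides of the Cartan relation.
\<close>

lemma cartan_zeta_boundary:
  assumes A: "chain_complex A" and \<psi>: "C_graded_map 0 W (C_restrict (End_operad A)) \<psi>"
    and rel: "cartan_relator A \<psi> H" and "odd p"
    and cyc: "modp_cycle p A a" "modp_cycle p A b"
  shows "bd A (zeta_deg p i a b) (cartan_zeta H p i a b) - cartan_C \<psi> p i a b
         \<in> pmult p A (zeta_deg p i a b - 1)"
proof -
  define X where "X = replicate p a @ replicate p b"
  let ?D = "zeta_deg p i a b" and ?f = "H p (int i) (wgen i)"
  note cl = add_subgroup_closed[OF pmult_subgroup[OF A, of p "?D - 1"]]
  have p: "0 < p" using \<open>odd p\<close> by (rule odd_pos)
  note a = modp_cycle_chains[OF cyc(1)] and b = modp_cycle_chains[OF cyc(2)]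
  have H: "C_graded_map 1 W (C_hat (End_operad A)) H"
    using rel by (simp add: cartan_relator_def C_homotopy_def)
  have X: "homog (replicate (2 * p) A) X" using power_pair_homog[OF a b] by (simp add: X_def)
  have "wgen i \<in> chains (cmx W p) (int i)" using p by (simp add: wgen_def)
  then have "bd (cmx (C_hat (End_operad A)) p) (int i + 1) ?f
      + H p (int i - 1) (bd (cmx W p) (int i) (wgen i))
      = cartan_tauF (End_operad A) \<psi> p (int i) (wgen i) - cartan_G (End_operad A) \<psi> p (int i) (wgen i)"
    using rel p by (simp add: cartan_relator_def C_homotopy_def)
  from fun_cong[OF this, of X]
  have homotopy: "bd A ?D (cartan_zeta H p i a b)
        - ksign (int i + 1) (on_tensor_bd (replicate (2 * p) A) ?f X)
        + H p (int i - 1) (bd (cmx W p) (int i) (wgen i)) X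
      = cartan_tauF (End_operad A) \<psi> p (int i) (wgen i) X
        - cartan_G (End_operad A) \<psi> p (int i) (wgen i) X"
    using X tdeg_power_pair[of p a b i]
    by (simp add: C_hat_def End_operad_def End_cplx_def cartan_zeta_def X_def[symmetric])
  have 1: "ksign (int i + 1) (on_tensor_bd (replicate (2 * p) A) ?f X) \<in> pmult p A (?D - 1)"
  proof (rule cl(5))
    have "on_tensor_bd (replicate (2 * p) A) ?f X \<in> pmult p A (tdeg X + (int i + 1) - 1)"
      by (rule on_tensor_bd_pmult[OF A relator_generator_chains[OF H p] X]) (use cyc in \<open>auto simp: X_def nth_append\<close>)
    then show "on_tensor_bd (replicate (2 * p) A) ?f X \<in> pmult p A (?D - 1)"
      by (simp only: X_def tdeg_power_pair)
  qed
  have 2: "H p (int i - 1) (bd (cmx W p) (int i) (wgen i)) X \<in> pmult p A (?D - 1)"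
    using relator_W_bd[OF A H \<open>odd p\<close> a b, of i] by (simp add: X_def zeta_deg_def)
  have 3: "cartan_tauF (End_operad A) \<psi> p (int i) (wgen i) X
      - cartan_G (End_operad A) \<psi> p (int i) (wgen i) X - cartan_C \<psi> p i a b \<in> pmult p A (?D - 1)"
    using G_power_pair[OF A \<psi> \<open>odd p\<close> a b, of i] tauF_power_pair[OF \<open>odd p\<close> a b, of \<psi> "int i" "wgen i"]
    by (simp add: X_def zeta_deg_def psi_power_def)
  have "bd A ?D (cartan_zeta H p i a b) - cartan_C \<psi> p i a b
      = ksign (int i + 1) (on_tensor_bd (replicate (2 * p) A) ?f X)
        - H p (int i - 1) (bd (cmx W p) (int i) (wgen i)) X
        + (cartan_tauF (End_operad A) \<psi> p (int i) (wgen i) X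
           - cartan_G (End_operad A) \<psi> p (int i) (wgen i) X - cartan_C \<psi> p i a b)"
    unfolding homotopy[symmetric] by (simp add: algebra_simps)
  then show ?thesis using cl(4)[OF cl(2)[OF 1 2] 3] by (simp only:)
qed

lemma cartan_zeta_cong:
  assumes A: "chain_complex A" and H: "C_graded_map 1 W (C_hat (End_operad A)) H" and p: "0 < p"
    and mem: "a \<in> chains A m" "a' \<in> chains A m" "b \<in> chains A n" "b' \<in> chains A n"
    and cong: "a - a' \<in> pmult p A m" "b - b' \<in> pmult p A n"
  shows "cartan_zeta H p i (m, a) (n, b) - cartan_zeta H p i (m, a') (n, b')
         \<in> pmult p A (zeta_deg p i (m, a) (n, b))"
  unfolding cartan_zeta_def tdeg_power_pair[symmetric]
  using mem cong
  by (intro multilinear_cong_pmult[OF A relator_generator_chains[OF H p] power_pair_homog power_pair_homog])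
     (auto simp: nth_append)

lemma cartan_zeta_natural:
  assumes "intertwines A f (2 * p) (int i + 1) (H p (int i) (wgen i)) (H' p (int i) (wgen i))"
    and a: "modp_cycle p A a" and b: "modp_cycle p A b"
  shows "f (zeta_deg p i a b) (cartan_zeta H p i a b) = cartan_zeta H' p i (hmap f a) (hmap f b)"
proof -
  let ?X = "replicate p a @ replicate p b"
  have "homog (replicate (2 * p) A) ?X"
    using power_pair_homog[OF modp_cycle_chains[OF a] modp_cycle_chains[OF b]] .
  then have "f (tdeg ?X + (int i + 1)) (H p (int i) (wgen i) ?X) = H' p (int i) (wgen i) (map (hmap f) ?X)"
    using assms(1) unfolding intertwines_def by blast
  then show ?thesis
    unfolding tdeg_power_pair by (simp add: cartan_zeta_def)
qed

theorem mainTheorem1: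
  fixes p i :: nat
    and R :: "'o::ab_group_add operad_data"
    and A :: "'a::ab_group_add cplx"
    and \<phi> :: "nat \<Rightarrow> int \<Rightarrow> 'o \<Rightarrow> 'a multimap"
    and \<iota> :: "nat \<Rightarrow> int \<Rightarrow> wres \<Rightarrow> 'o"
    and H :: "nat \<Rightarrow> int \<Rightarrow> wres \<Rightarrow> 'a multimap"
  assumes "prime p" and "odd p"
    and "May_Steenrod R A \<phi> \<iota>"
    and "cartan_relator A (psi_of \<phi> \<iota>) H"
  shows
    "\<comment> \<open>a map from pairs of mod p cycles to A, compatible with reduction mod p\<close>
     (\<forall>a b. modp_cycle p A a \<and> modp_cycle p A b \<longrightarrow>
        cartan_zeta H p i a b \<in> chains A (zeta_deg p i a b)) \<and>
     (\<forall>m n a a' b b'.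
        modp_cycle p A (m, a) \<and> modp_cycle p A (m, a') \<and> modp p A m a = modp p A m a' \<and>
        modp_cycle p A (n, b) \<and> modp_cycle p A (n, b') \<and> modp p A n b = modp p A n b' \<longrightarrow>
        modp p A (zeta_deg p i (m, a) (n, b)) (cartan_zeta H p i (m, a) (n, b))
        = modp p A (zeta_deg p i (m, a') (n, b')) (cartan_zeta H p i (m, a') (n, b'))) \<and>
     \<comment> \<open>the boundary formula in A tensor F_p\<close>
     (\<forall>a b. modp_cycle p A a \<and> modp_cycle p A b \<longrightarrow>
        modp p A (zeta_deg p i a b - 1) (bd A (zeta_deg p i a b) (cartan_zeta H p i a b))
        = modp p A (zeta_deg p i a b - 1) (cartan_C (psi_of \<phi> \<iota>) p i a b)) \<and>
     \<comment> \<open>naturality\<close>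
     (\<forall>(B :: 'b::ab_group_add cplx) \<phi>' H' f a b.
        May_Steenrod R B \<phi>' \<iota> \<and> cartan_relator B (psi_of \<phi>' \<iota>) H' \<and> E_infinity_map R A \<phi> B \<phi>' f \<and>
        relators_correspond A H H' f \<and> modp_cycle p A a \<and> modp_cycle p A b \<longrightarrow>
        f (zeta_deg p i a b) (cartan_zeta H p i a b) = cartan_zeta H' p i (hmap f a) (hmap f b)) \<and>
     (\<forall>(B :: 'b::ab_group_add cplx) \<phi>' H' K f a b.
        May_Steenrod R B \<phi>' \<iota> \<and> cartan_relator B (psi_of \<phi>' \<iota>) H' \<and> E_infinity_map R A \<phi> B \<phi>' f \<and>
        induced_relator R K \<phi> H \<and> induced_relator R K \<phi>' H' \<and> modp_cycle p A a \<and> modp_cycle p A b \<longrightarrow>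
        f (zeta_deg p i a b) (cartan_zeta H p i a b) = cartan_zeta H' p i (hmap f a) (hmap f b))"
proof -
  note A = assms(3)[unfolded May_Steenrod_def, THEN conjunct1]
  have p: "0 < p" using assms(1) by (rule prime_gt_0_nat)
  note \<psi> = May_Steenrod_psi[OF assms(3)]
  have H: "C_graded_map 1 W (C_hat (End_operad A)) H"
    using assms(4) by (simp add: cartan_relator_def C_homotopy_def)
  have wgen: "wgen i \<in> chains (cmx W p) (int i)" using p by (simp add: wgen_def)
  show ?thesis
  proof (intro conjI allI impI)
    fix a b assume "modp_cycle p A a \<and> modp_cycle p A b"
    then have "homog (replicate (2 * p) A) (replicate p a @ replicate p b)"
      by (intro power_pair_homog modp_cycle_chains) auto
    from End_chainsD(2)[OF relator_generator_chains[OF H p] this]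
    show "cartan_zeta H p i a b \<in> chains A (zeta_deg p i a b)"
      unfolding tdeg_power_pair cartan_zeta_def .
  next
    fix m n a a' b b'
    assume *: "modp_cycle p A (m, a) \<and> modp_cycle p A (m, a') \<and> modp p A m a = modp p A m a' \<and>
      modp_cycle p A (n, b) \<and> modp_cycle p A (n, b') \<and> modp p A n b = modp p A n b'"
    have "cartan_zeta H p i (m, a) (n, b) - cartan_zeta H p i (m, a') (n, b')
        \<in> pmult p A (zeta_deg p i (m, a) (n, b))"
      using * by (intro cartan_zeta_cong[OF A H p]) (auto simp: modp_cycle_def modp_eq_iff[OF A])
    moreover have "zeta_deg p i (m, a') (n, b') = zeta_deg p i (m, a) (n, b)"
      by (simp add: zeta_deg_def)
    ultimately show "modp p A (zeta_deg p i (m, a) (n, b)) (cartan_zeta H p i (m, a) (n, b))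
        = modp p A (zeta_deg p i (m, a') (n, b')) (cartan_zeta H p i (m, a') (n, b'))"
      by (simp add: modp_eq_iff[OF A])
  next
    fix a b assume "modp_cycle p A a \<and> modp_cycle p A b"
    then show "modp p A (zeta_deg p i a b - 1) (bd A (zeta_deg p i a b) (cartan_zeta H p i a b))
        = modp p A (zeta_deg p i a b - 1) (cartan_C (psi_of \<phi> \<iota>) p i a b)"
      using cartan_zeta_boundary[OF A \<psi> assms(4,2)] by (simp add: modp_eq_iff[OF A])
  next
    fix B :: "'b cplx" and \<phi>' H' f a b
    assume *: "May_Steenrod R B \<phi>' \<iota> \<and> cartan_relator B (psi_of \<phi>' \<iota>) H' \<and> E_infinity_map R A \<phi> B \<phi>' f \<and>
      relators_correspond A H H' f \<and> modp_cycle p A a \<and> modp_cycle p A b"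
    then have "intertwines A f (2 * p) (int i + 1) (H p (int i) (wgen i)) (H' p (int i) (wgen i))"
      using p wgen unfolding relators_correspond_def by blast
    then show "f (zeta_deg p i a b) (cartan_zeta H p i a b) = cartan_zeta H' p i (hmap f a) (hmap f b)"
      using * by (intro cartan_zeta_natural) auto
  next
    fix B :: "'b cplx" and \<phi>' H' K f a b
    assume *: "May_Steenrod R B \<phi>' \<iota> \<and> cartan_relator B (psi_of \<phi>' \<iota>) H' \<and> E_infinity_map R A \<phi> B \<phi>' f \<and>
      induced_relator R K \<phi> H \<and> induced_relator R K \<phi>' H' \<and> modp_cycle p A a \<and> modp_cycle p A b"
    then have "C_graded_map 1 W (C_hat R) K" by (simp add: induced_relator_def)
    from C_graded_map_chains[OF this p, of i]
    have "K p (int i) (wgen i) \<in> chains (opc R (2 * p)) (int i + 1)" by (simp add: C_hat_def)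
    moreover have "0 < 2 * p" using p by simp
    ultimately have "intertwines A f (2 * p) (int i + 1) (\<phi> (2 * p) (int i + 1) (K p (int i) (wgen i)))
        (\<phi>' (2 * p) (int i + 1) (K p (int i) (wgen i)))"
      using * unfolding E_infinity_map_def by blast
    then have "intertwines A f (2 * p) (int i + 1) (H p (int i) (wgen i)) (H' p (int i) (wgen i))"
      using * p wgen unfolding induced_relator_def by metis
    then show "f (zeta_deg p i a b) (cartan_zeta H p i a b) = cartan_zeta H' p i (hmap f a) (hmap f b)"
      using * by (intro cartan_zeta_natural) auto
  qed
qed

end
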